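(* Let $n\ge 1$ and let $W=W(BC_n)$ be the Coxeter group of type $BC_n$, with longest element $w_o$ (which is central and acts as $-1$ in the reflection representation). For integers $l\in\{0,\dots,n\}$ and $k\in\{0,\dots,\lfloor (n-l)/2\rfloor\}$ let $$I_{k,l}=\{2i-1 : 1\le i\le k\}\cup\{j : n-l+1\le j\le n\}\subset\{1,\dots,n\}$$ and $c_{k,l}:=w_{I_{k,l}}$. Then each involution in $W$ is conjugate to precisely one of the involutions $c_{k,l}$, and for all such $k,l$ the element $w_o c_{k,l}$ is conjugate in $W$ to $c_{k,\,n-2k-l}$.
   Context: The Coxeter graph $BC_n$ is the path with nodes $1,\dots,n$, in which the edge between $n-1$ and $n$ has label $4$ and all other edges have label $3$ (so $W(BC_n)$ is the hyperoctahedral group, and $BC_1=A_1$). Node $i$ corresponds to the simple generator $s_i$. For a set of nodes $I$, $W_I$ denotes the parabolic subgroup generated by $\{s_i: i\in I\}$, and $w_I$ denotes its longest element. An involution is an element $x$ with $x^2=1$ (the identity is included). *)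

theory Defs
  imports Complex_Main "HOL-Algebra.Generated_Groups"
begin

(* A Coxeter matrix m on a set N of nodes is a function with m i i = 1;
   the value 0 encodes the label infinity. *)

inductive coxeter_eq :: "'a set \<Rightarrow> ('a \<Rightarrow> 'a \<Rightarrow> nat) \<Rightarrow> 'a list \<Rightarrow> 'a list \<Rightarrow> bool"
  for N :: "'a set" and m :: "'a \<Rightarrow> 'a \<Rightarrow> nat" where
  refl: "u \<in> lists N \<Longrightarrow> coxeter_eq N m u u"
| sym: "coxeter_eq N m u v \<Longrightarrow> coxeter_eq N m v u"
| trans: "coxeter_eq N m u v \<Longrightarrow> coxeter_eq N m v w \<Longrightarrow> coxeter_eq N m u w"
| relator: "u \<in> lists N \<Longrightarrow> v \<in> lists N \<Longrightarrow> i \<in> N \<Longrightarrow> j \<in> N \<Longrightarrow>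
    coxeter_eq N m (u @ concat (replicate (m i j) [i, j]) @ v) (u @ v)"

definition coxeter_class :: "'a set \<Rightarrow> ('a \<Rightarrow> 'a \<Rightarrow> nat) \<Rightarrow> 'a list \<Rightarrow> 'a list set" where
  "coxeter_class N m w = {v. coxeter_eq N m w v}"

(* The group presented by generators s_i (i in N) and relations (s_i s_j)^(m i j) = 1.
   Words without inverse letters suffice, because the relators with i = j say s_i s_i = 1.
   An element is the set of all words representing it. *)
definition coxeter_group :: "'a set \<Rightarrow> ('a \<Rightarrow> 'a \<Rightarrow> nat) \<Rightarrow> 'a list set monoid" where
  "coxeter_group N m =
    \<lparr> carrier = lists N // {(u, v). coxeter_eq N m u v},
      mult = (\<lambda>X Y. \<Union>x\<in>X. \<Union>y\<in>Y. coxeter_class N m (x @ y)),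
      one = coxeter_class N m [] \<rparr>"

definition simple_gen :: "'a set \<Rightarrow> ('a \<Rightarrow> 'a \<Rightarrow> nat) \<Rightarrow> 'a \<Rightarrow> 'a list set" where
  "simple_gen N m i = coxeter_class N m [i]"

definition coxeter_length :: "'a list set \<Rightarrow> nat" where
  "coxeter_length x = (LEAST r. \<exists>w\<in>x. length w = r)"

definition parabolic :: "'a set \<Rightarrow> ('a \<Rightarrow> 'a \<Rightarrow> nat) \<Rightarrow> 'a set \<Rightarrow> 'a list set set" where
  "parabolic N m I = generate (coxeter_group N m) (simple_gen N m ` I)"

(* Length is measured in the whole group; on a parabolic subgroup it agrees with the
   length with respect to the subgroup's own simple generators. *)
definition longest_element :: "'a set \<Rightarrow> ('a \<Rightarrow> 'a \<Rightarrow> nat) \<Rightarrow> 'a set \<Rightarrow> 'a list set" where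
  "longest_element N m I =
    (THE x. x \<in> parabolic N m I \<and> (\<forall>y\<in>parabolic N m I. coxeter_length y \<le> coxeter_length x))"

(* The reflection representation on the real vector space with basis the simple roots
   a_i (i in N), with bilinear form B(a_i, a_j) = - cos (pi / m i j).  A vector is its
   coefficient function, vanishing outside N.  For m i j = 0 (infinity) the form is -1,
   since pi / 0 = 0 in HOL. *)
definition reflection_space :: "'a set \<Rightarrow> ('a \<Rightarrow> real) set" where
  "reflection_space N = {v. \<forall>j. j \<notin> N \<longrightarrow> v j = 0}"

definition simple_reflection ::
  "'a set \<Rightarrow> ('a \<Rightarrow> 'a \<Rightarrow> nat) \<Rightarrow> 'a \<Rightarrow> ('a \<Rightarrow> real) \<Rightarrow> ('a \<Rightarrow> real)" where
  "simple_reflection N m i v = v(i := v i - 2 * (\<Sum>j\<in>N. - cos (pi / real (m i j)) * v j))"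

definition reflection_rep ::
  "'a set \<Rightarrow> ('a \<Rightarrow> 'a \<Rightarrow> nat) \<Rightarrow> 'a list set \<Rightarrow> ('a \<Rightarrow> real) \<Rightarrow> ('a \<Rightarrow> real)" where
  "reflection_rep N m x = the_elem ((\<lambda>w. foldr (simple_reflection N m) w) ` x)"

definition is_involution :: "('g, 'b) monoid_scheme \<Rightarrow> 'g \<Rightarrow> bool" where
  "is_involution G x \<longleftrightarrow> x \<in> carrier G \<and> x \<otimes>\<^bsub>G\<^esub> x = \<one>\<^bsub>G\<^esub>"

definition conjugate_in :: "('g, 'b) monoid_scheme \<Rightarrow> 'g \<Rightarrow> 'g \<Rightarrow> bool" where
  "conjugate_in G x y \<longleftrightarrow> (\<exists>g\<in>carrier G. y = g \<otimes>\<^bsub>G\<^esub> x \<otimes>\<^bsub>G\<^esub> inv\<^bsub>G\<^esub> g)"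

definition BC_matrix :: "nat \<Rightarrow> nat \<Rightarrow> nat \<Rightarrow> nat" where
  "BC_matrix n i j =
    (if i = j then 1
     else if Suc i = j \<or> Suc j = i then (if max i j = n then 4 else 3)
     else 2)"

definition W_BC :: "nat \<Rightarrow> nat list set monoid" where
  "W_BC n = coxeter_group {1..n} (BC_matrix n)"

definition w_BC :: "nat \<Rightarrow> nat set \<Rightarrow> nat list set" where
  "w_BC n I = longest_element {1..n} (BC_matrix n) I"

definition I_BC :: "nat \<Rightarrow> nat \<Rightarrow> nat \<Rightarrow> nat set" where
  "I_BC n k l = {2 * i - 1 | i. 1 \<le> i \<and> i \<le> k} \<union> {j. n - l + 1 \<le> j \<and> j \<le> n}"

definition c_BC :: "nat \<Rightarrow> nat \<Rightarrow> nat \<Rightarrow> nat list set" where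
  "c_BC n k l = w_BC n (I_BC n k l)"

definition index_BC :: "nat \<Rightarrow> (nat \<times> nat) set" where
  "index_BC n = {(k, l). l \<le> n \<and> k \<le> (n - l) div 2}"

end

theory Submission
  imports Defs
begin

text \<open>Sending \<open>s\<^sub>i\<close> to a signed transposition defines a homomorphism from \<open>W(BC\<^sub>n)\<close> onto the group of signed
  permutations. It is injective: every word over the nodes \<open>n-q, \<dots>, n\<close> is equivalent to a word over
  \<open>n-q+1, \<dots>, n\<close> followed by one of \<open>2q + 2\<close> coset representatives, and only the trivial representative fixes
  the signed coordinate of node \<open>n-q\<close>.
  The same normal forms bound the length of every element of \<open>W\<^bsub>I\<^esub>\<close>, \<open>I = I\<^bsub>k,l\<^esub>\<close>, by \<open>l\<^sup>2 + k\<close>, with equality only for one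
  word, and counting inversions shows that this word is reduced; hence \<open>c\<^bsub>k,l\<^esub>\<close> negates \<open>l\<close> coordinates and
  exchanges \<open>k\<close> other pairs of coordinates.
  Two signed involutions are conjugate iff they negate equally many and fix equally many coordinates, and
  multiplication with \<open>w\<^sub>o = -1\<close> interchanges these two numbers.\<close>

section \<open>Coxeter groups as groups of words\<close>

text \<open>Length and reflection representation are defined through all words of a class. Rewriting
  words bounds length only from above; a lower bound needs a quantity invariant under the relations,
  here the inversions of the signed permutation. Since faithfulness of \<open>word_perm\<close> is
  itself a consequence of the rewriting, the rewriting must rest on braid relations alone.
  Inductions run along the chain of subgroups on the nodes \<open>n - r + 1, ..., n\<close>;
  numbering coordinates from that end makes them act on \<open>1, ..., r\<close> up to sign at every
  stage. \<open>longest_element\<close> is a definite description, so the upper bounds carry along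
  the uniqueness of the word attaining them. In the conjugacy problem the sign of an exchange
  carries no information: negating one coordinate turns \<open>x -> y\<close> into
  \<open>x -> - y\<close>.\<close>

lemma coxeter_eq_lists:
  assumes "coxeter_eq N m u v"
  shows "u \<in> lists N" "v \<in> lists N"
proof -
  have "u \<in> lists N \<and> v \<in> lists N"
    using assms
  proof induction
    case (relator u v i j)
    then have "concat (replicate (m i j) [i, j]) \<in> lists N"
      by (induction "m i j") (auto simp: in_lists_conv_set)
    with relator show ?case by simp
  qed simp_all
  then show "u \<in> lists N" "v \<in> lists N" by auto
qed

lemma coxeter_eq_context:
  assumes "coxeter_eq N m u v" "p \<in> lists N" "q \<in> lists N"
  shows "coxeter_eq N m (p @ u @ q) (p @ v @ q)"
  using assms(1)
proof induction
  case (refl u)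
  then show ?case using assms by (intro coxeter_eq.refl) simp
next
  case (relator u v i j)
  then show ?case
    using coxeter_eq.relator[of "p @ u" N "v @ q" i j m] assms by simp
qed (blast intro: coxeter_eq.intros)+

text \<open>Giving the context by equations lets a rewriting step name prefix and suffix and leaves
  the matching of concrete lists to simplification.\<close>

lemma coxeter_eq_subst:
  assumes "coxeter_eq N m u v" "x = p @ u @ q" "y = p @ v @ q" "p \<in> lists N" "q \<in> lists N"
  shows "coxeter_eq N m x y"
  using coxeter_eq_context[of N m u v p q] assms by simp

lemma coxeter_eq_append:
  assumes "coxeter_eq N m u u'" "coxeter_eq N m v v'"
  shows "coxeter_eq N m (u @ v) (u' @ v')"
proof (rule coxeter_eq.trans)
  show "coxeter_eq N m (u @ v) (u' @ v)"
    using coxeter_eq_context[OF assms(1), of "[]" v] assms(2) coxeter_eq_lists by fastforce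
  show "coxeter_eq N m (u' @ v) (u' @ v')"
    using coxeter_eq_context[OF assms(2), of "u'" "[]"] assms(1) coxeter_eq_lists by fastforce
qed

lemma coxeter_eq_class_iff:
  assumes "u \<in> lists N"
  shows "coxeter_class N m u = coxeter_class N m v \<longleftrightarrow> coxeter_eq N m u v"
proof
  assume "coxeter_class N m u = coxeter_class N m v"
  moreover have "u \<in> coxeter_class N m u"
    using assms by (simp add: coxeter_class_def coxeter_eq.refl)
  ultimately show "coxeter_eq N m u v"
    by (simp add: coxeter_class_def coxeter_eq.sym)
next
  assume "coxeter_eq N m u v"
  then show "coxeter_class N m u = coxeter_class N m v"
    unfolding coxeter_class_def by (auto intro: coxeter_eq.trans coxeter_eq.sym)
qed

lemma carrier_coxeter_group:
  "carrier (coxeter_group N m) = coxeter_class N m ` lists N"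
  by (auto simp: coxeter_group_def quotient_def coxeter_class_def)

lemma one_coxeter_group: "\<one>\<^bsub>coxeter_group N m\<^esub> = coxeter_class N m []"
  by (simp add: coxeter_group_def)

lemma mult_coxeter_class:
  assumes "u \<in> lists N" "v \<in> lists N"
  shows "coxeter_class N m u \<otimes>\<^bsub>coxeter_group N m\<^esub> coxeter_class N m v = coxeter_class N m (u @ v)"
proof -
  let ?X = "coxeter_class N m u" and ?Y = "coxeter_class N m v"
  have eq: "coxeter_class N m (x @ y) = coxeter_class N m (u @ v)"
    if "x \<in> coxeter_class N m u" "y \<in> coxeter_class N m v" for x y
  proof -
    have "coxeter_eq N m (u @ v) (x @ y)"
      by (rule coxeter_eq_append) (use that in \<open>simp_all add: coxeter_class_def\<close>)
    then show ?thesis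
      using coxeter_eq_class_iff[of "u @ v" N m "x @ y"] assms by simp
  qed
  have mem: "u \<in> ?X" "v \<in> ?Y"
    using assms by (simp_all add: coxeter_class_def coxeter_eq.refl)
  have "(\<Union>x\<in>?X. \<Union>y\<in>?Y. coxeter_class N m (x @ y)) =
      (\<Union>x\<in>?X. \<Union>y\<in>?Y. coxeter_class N m (u @ v))"
    by (intro SUP_cong HOL.refl eq)
  also have "\<dots> = coxeter_class N m (u @ v)"
    using mem by blast
  finally show ?thesis
    by (simp add: coxeter_group_def)
qed

lemma rev_in_lists: "rev w \<in> lists A \<longleftrightarrow> w \<in> lists A"
  by (simp add: in_lists_conv_set)

locale coxeter_matrix =
  fixes N :: "'a set" and m :: "'a \<Rightarrow> 'a \<Rightarrow> nat"
  assumes diagonal: "i \<in> N \<Longrightarrow> m i i = 1"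
begin

lemma coxeter_eq_square:
  assumes "i \<in> N"
  shows "coxeter_eq N m [i, i] []"
  using coxeter_eq.relator[of "[]" N "[]" i i m] assms diagonal by simp

text \<open>Cancellation works from the middle outwards, as every generator is its own inverse.
  Hence reversing a word inverts its class.\<close>

lemma coxeter_eq_append_rev:
  assumes "w \<in> lists N"
  shows "coxeter_eq N m (w @ rev w) []"
  using assms
proof (induction w)
  case Nil
  then show ?case by (simp add: coxeter_eq.refl)
next
  case (Cons i w)
  then have "coxeter_eq N m ([i] @ (w @ rev w) @ [i]) ([i] @ [] @ [i])"
    by (intro coxeter_eq_context) auto
  then show ?case
    using coxeter_eq_square[of i] Cons by (auto intro: coxeter_eq.trans)
qed

lemma coxeter_eq_rev_append:
  assumes "w \<in> lists N"
  shows "coxeter_eq N m (rev w @ w) []"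
  using coxeter_eq_append_rev[of "rev w"] assms by (simp add: rev_in_lists)

sublocale group "coxeter_group N m"
proof (rule groupI)
  fix x assume "x \<in> carrier (coxeter_group N m)"
  then obtain w where w: "w \<in> lists N" "x = coxeter_class N m w"
    by (auto simp: carrier_coxeter_group)
  have "coxeter_class N m (rev w) \<otimes>\<^bsub>coxeter_group N m\<^esub> x = \<one>\<^bsub>coxeter_group N m\<^esub>"
    using w coxeter_eq_rev_append[of w]
    by (simp add: mult_coxeter_class one_coxeter_group coxeter_eq_class_iff rev_in_lists)
  then show "\<exists>y\<in>carrier (coxeter_group N m). y \<otimes>\<^bsub>coxeter_group N m\<^esub> x = \<one>\<^bsub>coxeter_group N m\<^esub>"
    using w by (auto simp: carrier_coxeter_group rev_in_lists)
qed ((unfold carrier_coxeter_group one_coxeter_group)?, (elim imageE)?,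
     simp add: mult_coxeter_class imageI)+

lemma inv_coxeter_class:
  assumes "w \<in> lists N"
  shows "inv\<^bsub>coxeter_group N m\<^esub> coxeter_class N m w = coxeter_class N m (rev w)"
proof (rule inv_equality)
  show "coxeter_class N m (rev w) \<otimes>\<^bsub>coxeter_group N m\<^esub> coxeter_class N m w = \<one>\<^bsub>coxeter_group N m\<^esub>"
    using assms coxeter_eq_rev_append[OF assms]
    by (simp add: mult_coxeter_class one_coxeter_group coxeter_eq_class_iff rev_in_lists)
qed (use assms in \<open>auto simp: carrier_coxeter_group rev_in_lists\<close>)

lemma parabolic_eq_classes:
  assumes "I \<subseteq> N"
  shows "parabolic N m I = coxeter_class N m ` lists I"
proof
  have IN: "w \<in> lists N" if "w \<in> lists I" for w
    using lists_mono[OF assms] that by auto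
  show "parabolic N m I \<subseteq> coxeter_class N m ` lists I"
  proof
    fix x assume "x \<in> parabolic N m I"
    then show "x \<in> coxeter_class N m ` lists I"
      unfolding parabolic_def
    proof (induction rule: generate.induct)
      case one
      then show ?case by (simp add: one_coxeter_group)
    next
      case (incl h)
      then show ?case by (auto simp: simple_gen_def)
    next
      case (inv h)
      then obtain i where "i \<in> I" "h = coxeter_class N m [i]"
        by (auto simp: simple_gen_def)
      then show ?case
        using inv_coxeter_class[of "[i]"] assms by auto
    next
      case (eng h1 h2)
      then obtain u v where "u \<in> lists I" "v \<in> lists I"
        "h1 = coxeter_class N m u" "h2 = coxeter_class N m v" by auto
      then show ?case
        using IN[of u] IN[of v] by (simp add: mult_coxeter_class imageI)
    qed
  qed
  show "coxeter_class N m ` lists I \<subseteq> parabolic N m I"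
  proof (rule image_subsetI)
    fix w assume "w \<in> lists I"
    then show "coxeter_class N m w \<in> parabolic N m I"
    proof (induction w)
      case Nil
      show ?case
        unfolding parabolic_def one_coxeter_group[symmetric] by (rule generate.one)
    next
      case (Cons i w)
      then have "coxeter_class N m (i # w) =
          simple_gen N m i \<otimes>\<^bsub>coxeter_group N m\<^esub> coxeter_class N m w"
        using IN[of w] assms unfolding simple_gen_def
        by (subst mult_coxeter_class) auto
      with Cons show ?case
        by (simp add: parabolic_def generate.eng generate.incl)
    qed
  qed
qed

text \<open>Evaluating \<open>u @ rev v @ v\<close> in two ways turns a relator into an equation
  between words, the form used for rewriting.\<close>

lemma coxeter_eqI_append_rev:
  assumes "coxeter_eq N m (u @ rev v) []" "v \<in> lists N"
  shows "coxeter_eq N m u v"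
proof -
  have u: "u \<in> lists N" using coxeter_eq_lists(1)[OF assms(1)] by simp
  have "coxeter_eq N m (u @ (rev v @ v)) (u @ [])"
    by (intro coxeter_eq_append coxeter_eq.refl coxeter_eq_rev_append u assms)
  moreover have "coxeter_eq N m ((u @ rev v) @ v) ([] @ v)"
    by (intro coxeter_eq_append coxeter_eq.refl assms)
  ultimately show ?thesis
    by (auto intro: coxeter_eq.trans coxeter_eq.sym)
qed

end

lemma coxeter_length_le:
  assumes "coxeter_eq N m u v"
  shows "coxeter_length (coxeter_class N m u) \<le> length v"
  unfolding coxeter_length_def
  by (rule Least_le) (use assms in \<open>auto simp: coxeter_class_def\<close>)

lemma coxeter_length_ge:
  assumes "u \<in> lists N" "\<And>v. coxeter_eq N m u v \<Longrightarrow> r \<le> length v"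
  shows "r \<le> coxeter_length (coxeter_class N m u)"
proof -
  have "\<exists>w\<in>coxeter_class N m u. length w = length u"
    using assms(1) by (auto simp: coxeter_class_def intro: coxeter_eq.refl)
  then have "\<exists>w\<in>coxeter_class N m u. length w = coxeter_length (coxeter_class N m u)"
    unfolding coxeter_length_def by (rule LeastI)
  then obtain w where "w \<in> coxeter_class N m u" "length w = coxeter_length (coxeter_class N m u)"
    by blast
  then show ?thesis using assms(2)[of w] by (simp add: coxeter_class_def)
qed

text \<open>Think of \<open>U\<close> as representatives of the right cosets of the subgroup generated by \<open>J'\<close>.\<close>

lemma coxeter_eq_coset_rep:
  assumes "[] \<in> U" "J' \<subseteq> N" "J \<subseteq> N"
    and step: "\<And>u b. u \<in> U \<Longrightarrow> b \<in> J \<Longrightarrow>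
      \<exists>v\<in>lists J'. \<exists>u'\<in>U. coxeter_eq N m (u @ [b]) (v @ u')"
    and "w \<in> lists J"
  shows "\<exists>v\<in>lists J'. \<exists>u\<in>U. coxeter_eq N m w (v @ u)"
  using \<open>w \<in> lists J\<close>
proof (induction w rule: rev_induct)
  case Nil
  then show ?case using assms(1) by (auto intro!: bexI[of _ "[]"] coxeter_eq.refl)
next
  case (snoc b w)
  then obtain v u where vu: "v \<in> lists J'" "u \<in> U" "coxeter_eq N m w (v @ u)" by auto
  obtain v' u' where vu': "v' \<in> lists J'" "u' \<in> U" "coxeter_eq N m (u @ [b]) (v' @ u')"
    using step[of u b] vu snoc by auto
  have v: "v \<in> lists N" using vu(1) lists_mono[OF assms(2)] by auto
  have b: "b \<in> N" using snoc.prems assms(3) by auto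
  have "coxeter_eq N m (w @ [b]) ((v @ u) @ [b])"
    using coxeter_eq_append[OF vu(3) coxeter_eq.refl[of "[b]"]] b by simp
  also have "coxeter_eq N m ((v @ u) @ [b]) (v @ v' @ u')"
    using coxeter_eq_append[OF coxeter_eq.refl[OF v] vu'(3)] by simp
  finally (coxeter_eq.trans) have "coxeter_eq N m (w @ [b]) ((v @ v') @ u')" by simp
  then show ?case using vu vu' by (intro bexI[of _ "v @ v'"] bexI[of _ u']) auto
qed

section \<open>Signed permutations\<close>

definition signed_perms :: "nat \<Rightarrow> (int \<Rightarrow> int) set" where
  "signed_perms n = {g. bij g \<and> (\<forall>x. g (- x) = - g x) \<and> (\<forall>x. int n < \<bar>x\<bar> \<longrightarrow> g x = x)}"

text \<open>Node \<open>i\<close> acts on the signed coordinates \<open>\<plusminus>1, \<dots>, \<plusminus>n\<close> numbered from the end labelled \<open>4\<close>,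
  so that positive roots are the pairs \<open>x > y\<close> in the usual order of the integers.\<close>

definition bc_refl :: "nat \<Rightarrow> nat \<Rightarrow> int \<Rightarrow> int" where
  "bc_refl n i x =
    (if i = n then (if \<bar>x\<bar> = 1 then - x else x)
     else if \<bar>x\<bar> = int n + 1 - int i then x - sgn x
     else if \<bar>x\<bar> = int n - int i then x + sgn x
     else x)"

definition word_perm :: "nat \<Rightarrow> nat list \<Rightarrow> int \<Rightarrow> int" where
  "word_perm n w = foldr (\<lambda>i g. bc_refl n i \<circ> g) w id"

lemma word_perm_Nil [simp]: "word_perm n [] = id"
  by (simp add: word_perm_def)

lemma word_perm_Cons [simp]: "word_perm n (i # w) = bc_refl n i \<circ> word_perm n w"
  by (simp add: word_perm_def)

lemma word_perm_append [simp]: "word_perm n (u @ v) = word_perm n u \<circ> word_perm n v"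
  by (induction u) (auto simp: comp_assoc)

lemma bc_refl_minus: "bc_refl n i (- x) = - bc_refl n i x"
  by (simp add: bc_refl_def)

lemma bc_refl_bc_refl: "i \<le> n \<Longrightarrow> bc_refl n i (bc_refl n i x) = x"
  by (auto simp: bc_refl_def sgn_if abs_if split: if_splits)

lemma bc_refl_comp_self: "i \<le> n \<Longrightarrow> bc_refl n i \<circ> bc_refl n i = id"
  by (simp add: fun_eq_iff bc_refl_bc_refl)

lemma bc_refl_fixes: "i \<le> n \<Longrightarrow> int n + 1 - int i < \<bar>x\<bar> \<Longrightarrow> bc_refl n i x = x"
  by (auto simp: bc_refl_def)

lemma bij_bc_refl: "i \<le> n \<Longrightarrow> bij (bc_refl n i)"
  by (rule o_bij[of "bc_refl n i"]) (simp_all add: bc_refl_comp_self)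

lemma signed_perms_id: "id \<in> signed_perms n"
  by (simp add: signed_perms_def)

lemma signed_perms_comp:
  assumes "g \<in> signed_perms n" "h \<in> signed_perms n"
  shows "g \<circ> h \<in> signed_perms n"
  using assms by (auto simp: signed_perms_def bij_comp)

lemma bc_refl_in_signed_perms:
  assumes "1 \<le> i" "i \<le> n"
  shows "bc_refl n i \<in> signed_perms n"
  using assms by (auto simp: signed_perms_def bij_bc_refl bc_refl_minus intro!: bc_refl_fixes)

lemma word_perm_in_signed_perms:
  assumes "w \<in> lists {1..n}"
  shows "word_perm n w \<in> signed_perms n"
  using assms
  by (induction w rule: list.induct) (simp_all add: signed_perms_id signed_perms_comp bc_refl_in_signed_perms)

lemma word_perm_rev:
  assumes "w \<in> lists {..n}"
  shows "word_perm n (rev w) (word_perm n w x) = x" "word_perm n w (word_perm n (rev w) x) = x"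
proof -
  have *: "word_perm n (rev w) (word_perm n w x) = x" if "w \<in> lists {..n}" for w x
    using that
    by (induction w arbitrary: x rule: list.induct) (simp_all add: bc_refl_bc_refl)
  show "word_perm n (rev w) (word_perm n w x) = x" "word_perm n w (word_perm n (rev w) x) = x"
    using *[of w] *[of "rev w"] assms by (simp_all add: in_lists_conv_set)
qed

text \<open>Node \<open>i\<close> moves at most the coordinates \<open>n - i\<close> and
  \<open>n + 1 - i\<close> and their negatives, so nodes above \<open>n - r\<close> never reach past
  \<open>r\<close>.\<close>

lemma word_perm_fixes:
  assumes "w \<in> lists {n - r<..n}" "int r < \<bar>x\<bar>" "r \<le> n"
  shows "word_perm n w x = x"
  using assms by (induction w rule: list.induct) (auto intro!: bc_refl_fixes)

lemma bc_refl_pos: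
  assumes "i < n" "x > 0"
  shows "bc_refl n i x = (if x = int n + 1 - int i then x - 1 else if x = int n - int i then x + 1 else x)"
  using assms by (auto simp: bc_refl_def)

section \<open>The Coxeter relations for signed transpositions\<close>

lemma odd_eqI:
  fixes g :: "int \<Rightarrow> int"
  assumes "\<And>x. g (- x) = - g x" "\<And>x. x > 0 \<Longrightarrow> g x = x"
  shows "g x = x"
proof -
  have "g 0 = 0" using assms(1)[of 0] by simp
  moreover have "g x = x" if "x < 0" using assms(1)[of x] assms(2)[of "- x"] that by simp
  ultimately show ?thesis using assms(2)[of x] by (cases "x > 0"; cases "x = 0") simp_all
qed

lemma bc_refl_braid2:
  assumes "i \<le> n" "j \<le> n" "Suc i < j \<or> Suc j < i"
  shows "bc_refl n i (bc_refl n j (bc_refl n i (bc_refl n j x))) = x"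
proof (rule odd_eqI)
  fix x :: int assume "x > 0"
  consider "i < n" "j < n" | "j = n" "Suc i < n" | "i = n" "Suc j < n" using assms by linarith
  then show "bc_refl n i (bc_refl n j (bc_refl n i (bc_refl n j x))) = x"
  proof cases
    case 1
    then show ?thesis using \<open>x > 0\<close> assms(3) by (auto simp: bc_refl_pos)
  next
    case 2
    then show ?thesis using \<open>x > 0\<close> by (cases "x = 1") (auto simp: bc_refl_def)
  next
    case 3
    then show ?thesis using \<open>x > 0\<close> by (cases "x = 1") (auto simp: bc_refl_def)
  qed
qed (simp add: bc_refl_minus)

lemma bc_refl_braid3:
  assumes "i < n" "j < n" "Suc i = j \<or> Suc j = i"
  shows "bc_refl n i (bc_refl n j (bc_refl n i (bc_refl n j (bc_refl n i (bc_refl n j x))))) = x"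
proof (rule odd_eqI)
  fix x :: int assume "x > 0"
  then show "bc_refl n i (bc_refl n j (bc_refl n i (bc_refl n j (bc_refl n i (bc_refl n j x))))) = x"
    using assms
    by (cases "x = int n + 1 - int i"; cases "x = int n - int i";
        cases "x = int n + 1 - int j"; cases "x = int n - int j"; elim disjE)
      (simp_all add: bc_refl_pos)
qed (simp add: bc_refl_minus)

lemma bc_refl_last: "bc_refl n n x = (if \<bar>x\<bar> = 1 then - x else x)"
  by (simp add: bc_refl_def)

lemma bc_refl_last_but_one:
  "bc_refl (Suc i) i x = (if \<bar>x\<bar> = 2 then x - sgn x else if \<bar>x\<bar> = 1 then x + sgn x else x)"
  by (simp add: bc_refl_def)

lemma bc_refl_braid4:
  assumes "Suc i = j \<and> j = n \<or> Suc j = i \<and> i = n"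
  shows "bc_refl n i (bc_refl n j (bc_refl n i (bc_refl n j
    (bc_refl n i (bc_refl n j (bc_refl n i (bc_refl n j x))))))) = x"
proof -
  \<comment> \<open>Only the plane of the coordinates 1 and 2 is affected, where the product of the
    two reflections is a rotation of order 4.\<close>
  consider "x = 1" | "x = -1" | "x = 2" | "x = -2" | "\<bar>x\<bar> \<noteq> 1" "\<bar>x\<bar> \<noteq> 2" by linarith
  then show ?thesis using assms
    by cases (auto simp: bc_refl_last bc_refl_last_but_one)
qed

lemma word_perm_relator:
  assumes "i \<in> {1..n}" "j \<in> {1..n}"
  shows "word_perm n (concat (replicate (BC_matrix n i j) [i, j])) = id"
proof -
  consider "i = j" | "Suc i < j \<or> Suc j < i" | "i < n" "j < n" "Suc i = j \<or> Suc j = i"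
    | "Suc i = j \<and> j = n \<or> Suc j = i \<and> i = n"
    using assms by force
  then show ?thesis
  proof cases
    case 1
    then show ?thesis using assms
      by (simp add: BC_matrix_def bc_refl_comp_self)
  next
    case 2
    then have "BC_matrix n i j = Suc (Suc 0)" by (auto simp: BC_matrix_def)
    then show ?thesis using 2 assms bc_refl_braid2[of i n j] by (simp add: fun_eq_iff)
  next
    case 3
    then have "BC_matrix n i j = Suc (Suc (Suc 0))" by (auto simp: BC_matrix_def)
    then show ?thesis using 3 bc_refl_braid3[of i n j] by (simp add: fun_eq_iff)
  next
    case 4
    then have "BC_matrix n i j = Suc (Suc (Suc (Suc 0)))" by (auto simp: BC_matrix_def)
    then show ?thesis using 4 bc_refl_braid4[of i j n] by (simp add: fun_eq_iff)
  qed
qed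

lemma word_perm_cong:
  assumes "coxeter_eq {1..n} (BC_matrix n) u v"
  shows "word_perm n u = word_perm n v"
  using assms
proof induction
  case (relator u v i j)
  then show ?case using word_perm_relator[of i n j] by simp
qed simp_all

section \<open>Normal forms of words of type \<open>BC\<close>\<close>

interpretation BC: coxeter_matrix "{1..n}" "BC_matrix n" for n
  by unfold_locales (simp add: BC_matrix_def)

abbreviation bc_eq :: "nat \<Rightarrow> nat list \<Rightarrow> nat list \<Rightarrow> bool" where
  "bc_eq n \<equiv> coxeter_eq {1..n} (BC_matrix n)"

section \<open>Braid relations as rewriting rules\<close>

lemma bc_eq_relator:
  assumes "i \<in> {1..n}" "j \<in> {1..n}"
  shows "bc_eq n (concat (replicate (BC_matrix n i j) [i, j])) []"
  using coxeter_eq.relator[of "[]" "{1..n}" "[]" i j "BC_matrix n"] assms by simp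

lemma bc_eq_commute:
  assumes "i \<in> {1..n}" "j \<in> {1..n}" "Suc i < j \<or> Suc j < i"
  shows "bc_eq n [i, j] [j, i]"
proof (rule BC.coxeter_eqI_append_rev)
  have "BC_matrix n i j = Suc (Suc 0)" using assms by (auto simp: BC_matrix_def)
  then show "bc_eq n ([i, j] @ rev [j, i]) []" using bc_eq_relator[OF assms(1,2)] by simp
qed (use assms in auto)

lemma bc_eq_braid3:
  assumes "i \<in> {1..<n}" "j \<in> {1..<n}" "Suc i = j \<or> Suc j = i"
  shows "bc_eq n [i, j, i] [j, i, j]"
proof (rule BC.coxeter_eqI_append_rev)
  have "BC_matrix n i j = Suc (Suc (Suc 0))" using assms by (auto simp: BC_matrix_def)
  then show "bc_eq n ([i, j, i] @ rev [j, i, j]) []" using bc_eq_relator[of i n j] assms by simp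
qed (use assms in auto)

lemma bc_eq_braid4:
  assumes "i \<ge> 1" "Suc i = n"
  shows "bc_eq n [i, n, i, n] [n, i, n, i]"
proof (rule BC.coxeter_eqI_append_rev)
  have "BC_matrix n i n = Suc (Suc (Suc (Suc 0)))" using assms by (auto simp: BC_matrix_def)
  then show "bc_eq n ([i, n, i, n] @ rev [n, i, n, i]) []"
    using bc_eq_relator[of i n n] assms by simp
qed (use assms in auto)

declare coxeter_eq.trans [trans]

lemma bc_eq_commute_word:
  assumes "w \<in> lists {Suc a<..n}" "1 \<le> a" "a \<le> n"
  shows "bc_eq n (a # w) (w @ [a])"
  using assms(1)
proof (induction w rule: list.induct)
  case Nil
  show ?case using assms by (simp add: coxeter_eq.refl)
next
  case (Cons b w)
  then have b: "Suc a < b" "b \<le> n" and w: "w \<in> lists {Suc a<..n}" by auto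
  have wN: "w \<in> lists {1..n}"
    using w lists_mono[of "{Suc a<..n}" "{1..n}"] by auto
  have "bc_eq n (a # b # w) (b # a # w)"
    by (rule coxeter_eq_subst[OF bc_eq_commute[of a n b], of _ "[]" w])
      (use b assms wN in simp_all)
  also have "bc_eq n (b # a # w) (b # w @ [a])"
    by (rule coxeter_eq_subst[OF Cons.IH, of _ "[b]" "[]"])
      (use b w in simp_all)
  finally show ?case by simp
qed

text \<open>A palindrome with \<open>n\<close> in the middle: the sign change of coordinate
  \<open>r\<close>, obtained from that of coordinate 1 by conjugating with adjacent
  transpositions.\<close>

fun neg_word :: "nat \<Rightarrow> nat \<Rightarrow> nat list" where
  "neg_word n 0 = []"
| "neg_word n (Suc 0) = [n]"
| "neg_word n (Suc (Suc r)) = (n - Suc r) # neg_word n (Suc r) @ [n - Suc r]"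

lemma greaterThanAtMost_lists:
  fixes n q r :: nat
  assumes "w \<in> lists {n - q<..n}" "n - r \<le> n - q"
  shows "w \<in> lists {n - r<..n}" "w \<in> lists {1..n}" "w \<in> lists {..n}"
proof -
  have "n - r < x \<and> 1 \<le> x \<and> x \<le> n" if "x \<in> set w" for x
  proof -
    have "x \<in> {n - q<..n}" using assms(1) that unfolding in_lists_conv_set by blast
    then show ?thesis using assms(2) by simp
  qed
  then show "w \<in> lists {n - r<..n}" "w \<in> lists {1..n}" "w \<in> lists {..n}"
    by (simp_all add: in_lists_conv_set)
qed

lemma neg_word_in_lists:
  assumes "r \<le> n"
  shows "neg_word n r \<in> lists {n - r<..n}"
  using assms
proof (induction n r rule: neg_word.induct)
  case (3 n r)
  then show ?case
    using greaterThanAtMost_lists(1)[of "neg_word n (Suc r)" n "Suc r" "Suc (Suc r)"] by auto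
qed auto

lemma word_perm_neg_word:
  assumes "1 \<le> r" "r \<le> n"
  shows "word_perm n (neg_word n r) x = (if \<bar>x\<bar> = int r then - x else x)"
  using assms
proof (induction n r arbitrary: x rule: neg_word.induct)
  case (2 n)
  then show ?case by (simp add: bc_refl_def)
next
  case (3 n r)
  then have IH: "word_perm n (neg_word n (Suc r)) x = (if \<bar>x\<bar> = int (Suc r) then - x else x)" for x
    by simp
  have refl: "bc_refl n (n - Suc r) x =
    (if \<bar>x\<bar> = int r + 2 then x - sgn x else if \<bar>x\<bar> = int r + 1 then x + sgn x else x)" for x
  proof -
    have "n - Suc r \<noteq> n" "int (n - Suc r) = int n - int r - 1" using 3 by auto
    then show ?thesis by (simp add: bc_refl_def)
  qed
  consider "x = int r + 2" | "x = - int r - 2" | "x = int r + 1" | "x = - int r - 1"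
    | "\<bar>x\<bar> \<noteq> int r + 2" "\<bar>x\<bar> \<noteq> int r + 1" by linarith
  then show ?case
    by cases (simp_all add: IH refl)
qed simp

text \<open>The sign change of coordinate \<open>r + 1\<close> commutes with whatever acts on the
  coordinates up to \<open>r\<close>. This is derived from the relations, because equality of signed
  permutations does not yet give equivalence of words.\<close>

lemma neg_word_commute:
  assumes "Suc r \<le> n" "b \<in> {n - r<..n}"
  shows "bc_eq n (neg_word n (Suc r) @ [b]) (b # neg_word n (Suc r))"
  using assms
proof (induction r arbitrary: b)
  case 0
  then show ?case by simp
next
  case (Suc q)
  define a where "a = n - Suc q"
  define F where "F = neg_word n (Suc q)"
  have a: "1 \<le> a" "a < n" "n - q = Suc a" using Suc.prems by (auto simp: a_def)
  have F: "F \<in> lists {1..n}"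
    using neg_word_in_lists[of "Suc q" n] Suc.prems greaterThanAtMost_lists(2)[of F n "Suc q" "Suc q"]
    by (simp add: F_def)
  have NW: "neg_word n (Suc (Suc q)) = a # F @ [a]"
    by (simp add: a_def F_def)
  have Q: "b = Suc a \<Longrightarrow> q = 0 \<and> b = n \<and> Suc a = n \<or> (\<exists>p. q = Suc p \<and> b < n)"
    using a(3) Suc.prems(1) by (cases q) simp_all
  have "b \<in> {n - q<..n} \<or> b = Suc a" using Suc.prems a by (auto simp: a_def)
  \<comment> \<open>Nodes beyond \<open>Suc a\<close> commute with \<open>a\<close> and pass
    \<open>F\<close> by induction; only the neighbour \<open>Suc a\<close> calls for a braid
    relation, of length 4 at the end of the graph and of length 3 elsewhere.\<close>
  then consider "b \<in> {n - q<..n}" | "q = 0" "b = n" "Suc a = n"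
    | p where "q = Suc p" "b = Suc a" "b < n"
    using Q by blast
  then show ?case
  proof cases
    case 1
    then have b: "Suc a < b" "b \<le> n" using a by auto
    have IH: "bc_eq n (F @ [b]) (b # F)" using Suc.IH[of b] Suc.prems 1 by (simp add: F_def)
    have "bc_eq n (a # F @ [a, b]) (a # F @ [b, a])"
      by (rule coxeter_eq_subst[OF bc_eq_commute[of a n b], of _ "a # F" "[]"])
        (use a b F in simp_all)
    also have "bc_eq n (a # F @ [b, a]) (a # b # F @ [a])"
      by (rule coxeter_eq_subst[OF IH, of _ "[a]" "[a]"]) (use a b F in simp_all)
    also have "bc_eq n (a # b # F @ [a]) (b # a # F @ [a])"
      by (rule coxeter_eq_subst[OF bc_eq_commute[of a n b], of _ "[]" "F @ [a]"])
        (use a b F in simp_all)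
    finally show ?thesis by (simp only: NW append.simps append_assoc)
  next
    case 2
    then show ?thesis using bc_eq_braid4[of a n] a unfolding NW by (simp add: F_def)
  next
    \<comment> \<open>Here \<open>F = b F' b\<close> and \<open>F'\<close> commutes with
      \<open>a\<close>, so two moves between \<open>b a b\<close> and \<open>a b a\<close>, one on
      each side of \<open>F'\<close>, carry \<open>b\<close> from the right end to the left
      end.\<close>
    case 3
    define F' where "F' = neg_word n (Suc p)"
    have Fb: "F = b # F' @ [b]" using 3 a by (simp add: F_def F'_def)
    have F'a: "F' \<in> lists {Suc a<..n}"
      using neg_word_in_lists[of "Suc p" n] Suc.prems 3 a by (simp add: F'_def)
    have F': "F' \<in> lists {1..n}" using F Fb by simp
    have b: "b \<in> {1..<n}" and a': "a \<in> {1..<n}" using a 3 by auto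
    have comm: "bc_eq n (a # F') (F' @ [a])"
      by (rule bc_eq_commute_word[OF F'a]) (use a in simp_all)
    have "bc_eq n (a # b # F' @ [b, a, b]) (a # b # F' @ [a, b, a])"
      by (rule coxeter_eq_subst[OF bc_eq_braid3[of b n a], of _ "a # b # F'" "[]"])
        (use a' b F' 3 in simp_all)
    also have "bc_eq n (a # b # F' @ [a, b, a]) (a # b # a # F' @ [b, a])"
      by (rule coxeter_eq_subst[OF coxeter_eq.sym[OF comm], of _ "[a, b]" "[b, a]"])
        (use a' b F' in simp_all)
    also have "bc_eq n (a # b # a # F' @ [b, a]) (b # a # b # F' @ [b, a])"
      by (rule coxeter_eq_subst[OF bc_eq_braid3[of a n b], of _ "[]" "F' @ [b, a]"])
        (use a' b F' 3 in simp_all)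
    finally show ?thesis unfolding NW Fb by simp
  qed
qed

text \<open>Representatives of the right cosets of \<open>W\<^bsub>{n-q+1..n}\<^esub>\<close> in \<open>W\<^bsub>{n-q..n}\<^esub>\<close>, where \<open>r = Suc q\<close>:
  the prefixes of the palindrome \<open>s\<^bsub>n-q\<^esub> \<dots> s\<^bsub>n\<^esub> \<dots> s\<^bsub>n-q\<^esub>\<close>.\<close>

fun coset_words :: "nat \<Rightarrow> nat \<Rightarrow> nat list set" where
  "coset_words n 0 = {[]}"
| "coset_words n (Suc q) =
    insert [] (insert (neg_word n (Suc q)) ((#) (n - q) ` coset_words n q))"

lemma Nil_in_coset_words [simp]: "[] \<in> coset_words n r"
  by (cases r) auto

lemma coset_words_in_lists:
  assumes "u \<in> coset_words n r" "r \<le> n"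
  shows "u \<in> lists {n - r<..n}"
  using assms
proof (induction r arbitrary: u)
  case (Suc q)
  then consider "u = []" | "u = neg_word n (Suc q)"
    | u1 where "u = (n - q) # u1" "u1 \<in> coset_words n q" by auto
  then show ?case
  proof cases
    case 2
    then show ?thesis using neg_word_in_lists Suc.prems by blast
  next
    case 3
    then show ?thesis
      using Suc greaterThanAtMost_lists(1)[of u1 n q "Suc q"] by auto
  qed auto
qed auto

lemma length_neg_word: "length (neg_word n (Suc r)) = 2 * r + 1"
  by (induction r) auto

text \<open>That only the full palindrome attains the bound later makes the longest word unique. For
  \<open>r = 0\<close> truncated subtraction gives the correct bound 0.\<close>

lemma length_coset_words:
  assumes "u \<in> coset_words n r"
  shows "length u \<le> 2 * r - 1 \<and> (length u = 2 * r - 1 \<longrightarrow> u = neg_word n r)"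
  using assms
proof (induction r arbitrary: u)
  case (Suc q)
  then consider "u = []" | "u = neg_word n (Suc q)"
    | u1 where "u = (n - q) # u1" "u1 \<in> coset_words n q" by auto
  then show ?case
  proof cases
    case 3
    then show ?thesis
      using Suc.IH[of u1] Suc.prems by (cases q) auto
  qed (auto simp: length_neg_word)
qed auto

text \<open>A proper nonempty prefix starts with its only letter that moves coordinate
  \<open>r\<close>; letters act from right to left, so nothing brings \<open>r\<close> back. The
  full palindrome sends \<open>r\<close> to \<open>- r\<close>.\<close>

lemma coset_words_fixes:
  assumes "u \<in> coset_words n r" "r \<le> n" "word_perm n u (int r) = int r"
  shows "u = []"
proof (cases r)
  case 0
  then show ?thesis using assms by simp
next
  case (Suc q)
  then consider "u = []" | "u = neg_word n (Suc q)"
    | u1 where "u = (n - q) # u1" "u1 \<in> coset_words n q" using assms by auto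
  then show ?thesis
  proof cases
    case 2
    then show ?thesis using assms word_perm_neg_word[of r n "int r"] Suc by simp
  next
    case 3
    then have "word_perm n u1 (int r) = int r"
      using coset_words_in_lists[of u1 n q] assms Suc by (intro word_perm_fixes[of _ _ q]) auto
    then show ?thesis using 3 assms Suc
      by (auto simp: bc_refl_def of_nat_diff split: if_splits)
  qed
qed

text \<open>The multiplication table of the representatives, in the spirit of Deodhar's lemma:
  \<open>u\<close> times a generator is another representative, or the generator passes to the left
  of \<open>u\<close> as an element of the smaller subgroup.\<close>

lemma coset_words_step:
  assumes "Suc q \<le> n" "u \<in> coset_words n (Suc q)" "b \<in> {n - Suc q<..n}"
  shows "\<exists>v\<in>lists {n - q<..n}. \<exists>u'\<in>coset_words n (Suc q). bc_eq n (u @ [b]) (v @ u')"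
  using assms
proof (induction q arbitrary: u b rule: less_induct)
  case (less q)
  define a where "a = n - q"
  have a: "1 \<le> a" "a \<le> n" "n - Suc q < a" using less.prems by (auto simp: a_def)
  have U: "coset_words n (Suc q) =
      insert [] (insert (neg_word n (Suc q)) ((#) a ` coset_words n q))"
    by (simp add: a_def)
  note coset_words.simps(2) [simp del]
  have U_Cons: "a # u1 \<in> coset_words n (Suc q)" if "u1 \<in> coset_words n q" for u1
    using that by (simp add: U)
  have U_neg: "neg_word n (Suc q) \<in> coset_words n (Suc q)"
    by (simp add: U)
  have lists_N: "u1 \<in> lists {1..n}" if "u1 \<in> coset_words n q" for u1
    using coset_words_in_lists[OF that] less.prems greaterThanAtMost_lists(2)[of u1 n q q] by simp
  have sq: "bc_eq n [a, a] []" using BC.coxeter_eq_square[of a n] a by simp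
  have b: "b = a \<or> b \<in> {n - q<..n}" using less.prems a by (auto simp: a_def)
  have bN: "b \<in> {1..n}" using less.prems by auto
  have doneI: ?case if "v \<in> lists {n - q<..n}" "u' \<in> coset_words n (Suc q)" "bc_eq n (u @ [b]) (v @ u')"
    for v u' using that by blast
  from less.prems(2) U consider "u = []" | "u = neg_word n (Suc q)"
    | u1 where "u = a # u1" "u1 \<in> coset_words n q" by auto
  then show ?case
  proof cases
    case 1
    show ?thesis
    proof (cases "b = a")
      case True
      then show ?thesis using 1 a by (intro doneI[of "[]" "[a]"]) (auto simp: U_Cons U_neg intro!: coxeter_eq.refl)
    next
      case False
      then show ?thesis using 1 b bN by (intro doneI[of "[b]" "[]"]) (auto intro: coxeter_eq.refl)
    qed
  next
    case 2
    show ?thesis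
    proof (cases "b = a")
      case True
      show ?thesis
      proof (cases q)
        case 0
        then show ?thesis using 2 True sq by (intro doneI[of "[]" "[]"]) (auto simp: a_def)
      next
        case (Suc p)
        define F where "F = neg_word n q"
        have F: "F \<in> coset_words n q" using Suc by (simp add: F_def coset_words.simps(2))
        have "bc_eq n (u @ [b]) (a # F)"
          by (rule coxeter_eq_subst[OF sq, of _ "a # F" "[]"])
            (use 2 True Suc a lists_N[OF F] in \<open>simp_all add: F_def a_def\<close>)
        then show ?thesis using F by (intro doneI[of "[]" "a # F"]) (auto simp: U_Cons)
      qed
    next
      case False
      then have "b \<in> {n - q<..n}" using b by simp
      then have "bc_eq n (u @ [b]) ([b] @ u)"
        using neg_word_commute[of q n b] less.prems 2 by simp
      then show ?thesis using \<open>b \<in> {n - q<..n}\<close> less.prems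
        by (intro doneI[of "[b]" u]) auto
    qed
  next
    case 3
    note u1N = lists_N[OF 3(2)]
    show ?thesis
    proof (cases q)
      case 0
      then have "b = a" "u1 = []" using b 3 by auto
      then show ?thesis using 3 sq by (intro doneI[of "[]" "[]"]) auto
    next
      case (Suc p)
      then have ap: "n - p = Suc a" using less.prems by (auto simp: a_def)
      show ?thesis
      proof (cases "b = a")
        \<comment> \<open>The induction hypothesis takes \<open>b\<close> through \<open>u1\<close>
          and leaves \<open>v\<close> on nodes beyond \<open>Suc a\<close>, which commute with the
          first letter \<open>a\<close>.\<close>
        case False
        then have "b \<in> {n - Suc p<..n}" using b Suc by simp
        then obtain v u' where v: "v \<in> lists {n - p<..n}" and u': "u' \<in> coset_words n q"
          and IH: "bc_eq n (u1 @ [b]) (v @ u')"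
          using less.IH[of p u1 b] 3 less.prems Suc by auto
        have v': "v \<in> lists {n - q<..n}" "v \<in> lists {1..n}"
          using greaterThanAtMost_lists(1,2)[OF v, of q] Suc by auto
        have "bc_eq n (a # u1 @ [b]) (a # v @ u')"
          by (rule coxeter_eq_subst[OF IH, of _ "[a]" "[]"]) (use a in simp_all)
        also have "bc_eq n (a # v @ u') (v @ a # u')"
          by (rule coxeter_eq_subst[OF bc_eq_commute_word[of v a n], of _ "[]" u'])
            (use a v ap lists_N[OF u'] in simp_all)
        finally show ?thesis using 3 v' u' by (intro doneI[of v "a # u'"]) (auto simp: U_Cons)
      next
        case True
        \<comment> \<open>The word is \<open>a u1 a\<close>: it collapses for empty
          \<open>u1\<close>, completes the palindrome if \<open>u1\<close> is the smaller one, and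
          otherwise \<open>a\<close> moves left to meet \<open>Suc a\<close>.\<close>
        from 3(2) Suc ap coset_words.simps(2)[of n p] consider "u1 = []" | "u1 = neg_word n q"
          | u2 where "u1 = Suc a # u2" "u2 \<in> coset_words n p" by auto
        then show ?thesis
        proof cases
          case 1
          then show ?thesis using 3 sq True by (intro doneI[of "[]" "[]"]) auto
        next
          case 2
          have "u @ [b] = neg_word n (Suc q)" using 2 3 True Suc by (simp add: a_def)
          moreover have "neg_word n (Suc q) \<in> lists {1..n}"
            using neg_word_in_lists[of "Suc q" n] greaterThanAtMost_lists(2)[of _ n "Suc q" "Suc q"] less.prems
            by blast
          ultimately show ?thesis
            by (intro doneI[of "[]" "u @ [b]"]) (auto simp: U_Cons U_neg intro!: coxeter_eq.refl)
        next
          case u2: 3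
          have u2N: "u2 \<in> lists {1..n}" using u1N u2 by simp
          \<comment> \<open>For \<open>p = 0\<close> the node \<open>Suc a\<close> is
            \<open>n\<close>, so the edge has label 4 and no braid move of length 3 exists; but then
            \<open>a n a\<close> is already the full palindrome.\<close>
          show ?thesis
          proof (cases p)
            case 0
            then have "u @ [b] = neg_word n (Suc q)"
              using 3 u2 True Suc ap by (simp add: a_def)
            moreover have "u @ [b] \<in> lists {1..n}" using 3 u1N a True by simp
            ultimately show ?thesis
              by (intro doneI[of "[]" "u @ [b]"]) (auto simp: U_Cons U_neg intro!: coxeter_eq.refl)
          next
            case (Suc p')
            have lt: "Suc a < n" using ap Suc less.prems by linarith
            have "u2 \<in> lists {Suc a<..n}"
              using coset_words_in_lists[OF u2(2)] ap less.prems \<open>q = Suc p\<close> by simp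
            then have comm: "bc_eq n (a # u2) (u2 @ [a])"
              using a by (intro bc_eq_commute_word)
            have "bc_eq n (a # Suc a # u2 @ [a]) (a # Suc a # a # u2)"
              by (rule coxeter_eq_subst[OF coxeter_eq.sym[OF comm], of _ "[a, Suc a]" "[]"])
                (use a lt in simp_all)
            also have "bc_eq n (a # Suc a # a # u2) (Suc a # a # Suc a # u2)"
              by (rule coxeter_eq_subst[OF bc_eq_braid3[of a n "Suc a"], of _ "[]" u2])
                (use a lt u2N in simp_all)
            finally show ?thesis
              using 3 u2 True lt less.prems a
              by (intro doneI[of "[Suc a]" u]) (auto simp: a_def)
          qed
        qed
      qed
    qed
  qed
qed

lemma bc_eq_coset_decomposition:
  assumes "Suc q \<le> n" "w \<in> lists {n - Suc q<..n}"
  shows "\<exists>v\<in>lists {n - q<..n}. \<exists>u\<in>coset_words n (Suc q). bc_eq n w (v @ u)"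
  by (rule coxeter_eq_coset_rep[of _ _ _ "{n - Suc q<..n}"])
    (use assms coset_words_step in auto)

lemma bc_eq_Nil_if_word_perm_id:
  assumes "r \<le> n" "w \<in> lists {n - r<..n}" "word_perm n w = id"
  shows "bc_eq n w []"
  using assms
proof (induction r arbitrary: w)
  case 0
  then show ?case by (simp add: coxeter_eq.refl)
next
  case (Suc q)
  obtain v u where v: "v \<in> lists {n - q<..n}" and u: "u \<in> coset_words n (Suc q)"
    and w: "bc_eq n w (v @ u)"
    using bc_eq_coset_decomposition[of q n w] Suc.prems by blast
  have perm: "word_perm n v (word_perm n u x) = x" for x
    using word_perm_cong[OF w] Suc.prems(3) by (simp add: fun_eq_iff)
  \<comment> \<open>\<open>v\<close> and the whole word fix coordinate \<open>Suc q\<close>, hence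
    \<open>u\<close> does too, which singles out the trivial coset.\<close>
  have "word_perm n v (int (Suc q)) = int (Suc q)"
    by (rule word_perm_fixes[OF v]) (use Suc.prems in auto)
  then have "word_perm n u (int (Suc q)) = int (Suc q)"
    using perm[of "int (Suc q)"] word_perm_rev(1)[OF greaterThanAtMost_lists(3)[OF v order_refl]]
    by metis
  then have "u = []" using coset_words_fixes[OF u] Suc.prems by simp
  then have "bc_eq n v []" using Suc.IH[OF _ v] Suc.prems perm by (simp add: fun_eq_iff)
  then show ?case using w \<open>u = []\<close> by (auto intro: coxeter_eq.trans)
qed

lemma bc_eq_iff_word_perm:
  assumes "u \<in> lists {1..n}" "v \<in> lists {1..n}"
  shows "bc_eq n u v \<longleftrightarrow> word_perm n u = word_perm n v"
proof
  assume eq: "word_perm n u = word_perm n v"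
  have v: "v \<in> lists {..n}" using assms(2) lists_mono[of "{1..n}" "{..n}"] by auto
  have *: "{n - n<..n} = {1..n}" by auto
  have "bc_eq n (u @ rev v) []"
    using assms eq word_perm_rev(2)[OF v]
    by (intro bc_eq_Nil_if_word_perm_id[of n]) (auto simp: * fun_eq_iff rev_in_lists)
  then show "bc_eq n u v" using assms(2) by (rule BC.coxeter_eqI_append_rev)
qed (rule word_perm_cong)

section \<open>The longest elements\<close>

text \<open>A word for -1 on the coordinates up to \<open>l\<close>; its length is the sum of the
  first \<open>l\<close> odd numbers.\<close>

fun neg_block :: "nat \<Rightarrow> nat \<Rightarrow> nat list" where
  "neg_block n 0 = []"
| "neg_block n (Suc l) = neg_block n l @ neg_word n (Suc l)"

definition long_word :: "nat \<Rightarrow> nat \<Rightarrow> nat \<Rightarrow> nat list" where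
  "long_word n k l = neg_block n l @ map (\<lambda>i. 2 * i + 1) [0..<k]"

lemma I_BC_0: "I_BC n 0 l = {n - l<..n}"
  by (auto simp: I_BC_def)

lemma I_BC_Suc: "I_BC n (Suc k) l = insert (2 * k + 1) (I_BC n k l)"
proof -
  have "{2 * i - 1 | i. 1 \<le> i \<and> i \<le> Suc k} = insert (2 * k + 1) {2 * i - 1 | i::nat. 1 \<le> i \<and> i \<le> k}"
    by (force simp: le_Suc_eq)
  then show ?thesis by (simp add: I_BC_def)
qed

lemma I_BC_subset:
  assumes "2 * k + l \<le> n"
  shows "I_BC n k l \<subseteq> {1..n}"
  using assms by (auto simp: I_BC_def)

text \<open>The representatives at stage \<open>r\<close> have length at most
  \<open>2 * r - 1\<close>, and these odd numbers add up to \<open>l\<^sup>2\<close>; attaining the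
  total forces every factor to be a full palindrome.\<close>

lemma neg_block_normal_form:
  assumes "l \<le> n" "w \<in> lists {n - l<..n}"
  shows "\<exists>w'. bc_eq n w w' \<and> length w' \<le> l\<^sup>2 \<and> (length w' = l\<^sup>2 \<longrightarrow> w' = neg_block n l)"
  using assms
proof (induction l arbitrary: w)
  case 0
  then show ?case by (auto intro: coxeter_eq.refl)
next
  case (Suc l)
  obtain v u where v: "v \<in> lists {n - l<..n}" and u: "u \<in> coset_words n (Suc l)"
    and w: "bc_eq n w (v @ u)"
    using bc_eq_coset_decomposition[of l n w] Suc.prems by blast
  obtain v' where v': "bc_eq n v v'" "length v' \<le> l\<^sup>2" "length v' = l\<^sup>2 \<longrightarrow> v' = neg_block n l"
    using Suc.IH[OF _ v] Suc.prems by auto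
  have uN: "u \<in> lists {1..n}"
    using coset_words_in_lists[OF u] Suc.prems greaterThanAtMost_lists(2) by blast
  have lu: "length u \<le> 2 * l + 1" "length u = 2 * l + 1 \<longrightarrow> u = neg_word n (Suc l)"
    using length_coset_words[OF u] by simp_all
  have sq: "(Suc l)\<^sup>2 = l\<^sup>2 + (2 * l + 1)" by (simp add: power2_eq_square)
  have "bc_eq n (v @ u) (v' @ u)"
    by (rule coxeter_eq_append[OF v'(1) coxeter_eq.refl[OF uN]])
  with w have "bc_eq n w (v' @ u)" by (rule coxeter_eq.trans)
  moreover have "length (v' @ u) \<le> (Suc l)\<^sup>2" using v' lu sq by simp
  moreover have "v' @ u = neg_block n (Suc l)" if "length (v' @ u) = (Suc l)\<^sup>2"
  proof -
    have "length v' = l\<^sup>2" "length u = 2 * l + 1" using that v'(2) lu(1) sq by simp_all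
    then show ?thesis using v' lu by simp
  qed
  ultimately show ?case by blast
qed

lemma long_word_Suc: "long_word n (Suc k) l = long_word n k l @ [2 * k + 1]"
  by (simp add: long_word_def)

text \<open>An added odd node commutes with all nodes already in the set, so its cosets are
  represented by \<open>[]\<close> and the single letter, and it lengthens words by at most
  1.\<close>

lemma long_word_normal_form:
  assumes "2 * k + l \<le> n" "w \<in> lists (I_BC n k l)"
  shows "\<exists>w'. bc_eq n w w' \<and> length w' \<le> l\<^sup>2 + k \<and>
    (length w' = l\<^sup>2 + k \<longrightarrow> w' = long_word n k l)"
  using assms
proof (induction k arbitrary: w)
  case 0
  then show ?case using neg_block_normal_form[of l n w] by (simp add: I_BC_0 long_word_def)
next
  case (Suc k)
  define b where "b = 2 * k + 1"
  have b: "b \<in> {1..n}" using Suc.prems by (simp add: b_def)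
  have IN: "I_BC n k l \<subseteq> {1..n}" using I_BC_subset[of k l n] Suc.prems by simp
  have I: "I_BC n (Suc k) l = insert b (I_BC n k l)" by (simp add: I_BC_Suc b_def)
  have step: "\<exists>v\<in>lists (I_BC n k l). \<exists>u'\<in>{[], [b]}. bc_eq n (u @ [c]) (v @ u')"
    if uc: "u \<in> {[], [b]}" "c \<in> insert b (I_BC n k l)" for u c
  proof -
    have witness: ?thesis if "v \<in> lists (I_BC n k l)" "u' \<in> {[], [b]}" "bc_eq n (u @ [c]) (v @ u')"
      for v u' using that by blast
    consider "u = []" "c = b" | "u = []" "c \<in> I_BC n k l" | "u = [b]" "c = b"
      | "u = [b]" "c \<in> I_BC n k l"
      using uc by blast
    then show ?thesis
    proof cases
      case 1
      then show ?thesis by (intro witness[of "[]" "[b]"]) (use b in \<open>auto intro: coxeter_eq.refl\<close>)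
    next
      case 2
      then have "c \<in> {1..n}" using IN by blast
      then show ?thesis
        by (intro witness[of "[c]" "[]"]) (use 2 in \<open>auto intro!: coxeter_eq.refl\<close>)
    next
      case 3
      then show ?thesis
        by (intro witness[of "[]" "[]"]) (use BC.coxeter_eq_square[of b n] b in auto)
    next
      case 4
      \<comment> \<open>\<open>2 * Suc k + l \<le> n\<close> keeps the block, which starts at
        \<open>n - l + 1\<close>, at distance at least 2 from \<open>b\<close>; the earlier odd
        nodes stop at \<open>2 * k - 1\<close>.\<close>
      have "Suc b < c \<or> Suc c < b" using 4(2) Suc.prems by (auto simp: I_BC_def b_def)
      moreover have "c \<in> {1..n}" using 4 IN by blast
      ultimately have "bc_eq n [b, c] [c, b]" using bc_eq_commute b by blast
      then show ?thesis by (intro witness[of "[c]" "[b]"]) (use 4 in auto)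
    qed
  qed
  have "\<exists>v\<in>lists (I_BC n k l). \<exists>u\<in>{[], [b]}. bc_eq n w (v @ u)"
  proof (rule coxeter_eq_coset_rep[where J = "insert b (I_BC n k l)"])
    show "insert b (I_BC n k l) \<subseteq> {1..n}" using b IN by blast
    show "w \<in> lists (insert b (I_BC n k l))" using Suc.prems(2) unfolding I .
  qed (fact step | use IN in simp)+
  then obtain v u where v: "v \<in> lists (I_BC n k l)" and u: "u \<in> {[], [b]}"
    and w: "bc_eq n w (v @ u)"
    by blast
  obtain v' where v': "bc_eq n v v'" "length v' \<le> l\<^sup>2 + k"
    "length v' = l\<^sup>2 + k \<longrightarrow> v' = long_word n k l"
    using Suc.IH[OF _ v] Suc.prems by auto
  have uN: "u \<in> lists {1..n}" using u b by auto
  have "bc_eq n w (v' @ u)"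
    using w coxeter_eq_append[OF v'(1) coxeter_eq.refl[OF uN]] by (rule coxeter_eq.trans)
  moreover have "length (v' @ u) \<le> l\<^sup>2 + Suc k" using v'(2) u by auto
  moreover have "v' @ u = long_word n (Suc k) l" if "length (v' @ u) = l\<^sup>2 + Suc k"
    using that v' u by (auto simp: long_word_Suc b_def)
  ultimately show ?case by blast
qed

lemma long_word_in_lists:
  assumes "2 * k + l \<le> n"
  shows "long_word n k l \<in> lists (I_BC n k l)"
  using assms
proof (induction k)
  case 0
  have "neg_block n l \<in> lists {n - l<..n}" if "l \<le> n" for l
    using that
  proof (induction l)
    case (Suc l)
    then show ?case
      using neg_word_in_lists[of "Suc l" n] greaterThanAtMost_lists(1)[of "neg_block n l" n l "Suc l"]
      by simp
  qed auto
  then show ?case using 0 by (simp add: long_word_def I_BC_0)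
next
  case (Suc k)
  then show ?case
    using lists_mono[of "I_BC n k l" "I_BC n (Suc k) l"] by (auto simp: long_word_Suc I_BC_Suc)
qed

text \<open>Node \<open>2 * i + 1\<close> exchanges the coordinates \<open>n - 2 * i\<close> and
  \<open>n - 2 * i - 1\<close>, so the parity of the distance from \<open>n\<close> tells the upper
  from the lower member of a pair.\<close>

definition standard_involution :: "nat \<Rightarrow> nat \<Rightarrow> nat \<Rightarrow> int \<Rightarrow> int" where
  "standard_involution n k l x =
    (if \<bar>x\<bar> \<le> int l then - x
     else if int n - 2 * int k < \<bar>x\<bar> \<and> \<bar>x\<bar> \<le> int n
     then (if even (int n - \<bar>x\<bar>) then x - sgn x else x + sgn x)
     else x)"

lemma word_perm_neg_block:
  assumes "l \<le> n"
  shows "word_perm n (neg_block n l) x = (if \<bar>x\<bar> \<le> int l then - x else x)"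
  using assms
proof (induction l arbitrary: x)
  case (Suc l)
  then show ?case using word_perm_neg_word[of "Suc l" n x] by auto
qed auto

lemma standard_involution_Suc:
  assumes "2 * Suc k + l \<le> n"
  shows "standard_involution n (Suc k) l x = standard_involution n k l (bc_refl n (2 * k + 1) x)"
proof -
  have refl: "bc_refl n (2 * k + 1) x = (if \<bar>x\<bar> = int n - 2 * int k then x - sgn x
      else if \<bar>x\<bar> = int n - 2 * int k - 1 then x + sgn x else x)"
    using assms by (auto simp: bc_refl_def)
  consider "\<bar>x\<bar> = int n - 2 * int k" | "\<bar>x\<bar> = int n - 2 * int k - 1"
    | "\<bar>x\<bar> \<noteq> int n - 2 * int k" "\<bar>x\<bar> \<noteq> int n - 2 * int k - 1" by blast
  then show ?thesis
  proof cases
    case 1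
    then have "standard_involution n (Suc k) l x = x - sgn x"
      using assms by (simp add: standard_involution_def)
    moreover have "\<bar>x - sgn x\<bar> = int n - 2 * int k - 1" using 1 assms by (auto simp: sgn_if abs_if split: if_splits)
    then have "standard_involution n k l (x - sgn x) = x - sgn x"
      using assms by (simp add: standard_involution_def)
    moreover have "bc_refl n (2 * k + 1) x = x - sgn x" using refl 1 by simp
    ultimately show ?thesis by simp
  next
    case 2
    then have "standard_involution n (Suc k) l x = x + sgn x"
      using assms by (simp add: standard_involution_def)
    moreover have "\<bar>x + sgn x\<bar> = int n - 2 * int k" using 2 assms by (auto simp: sgn_if abs_if split: if_splits)
    then have "standard_involution n k l (x + sgn x) = x + sgn x"
      using assms by (simp add: standard_involution_def)
    moreover have "bc_refl n (2 * k + 1) x = x + sgn x" using refl 2 by simp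
    ultimately show ?thesis by simp
  next
    case 3
    then have "bc_refl n (2 * k + 1) x = x" using refl by simp
    with 3 show ?thesis using assms by (auto simp: standard_involution_def)
  qed
qed

lemma word_perm_long_word:
  assumes "2 * k + l \<le> n"
  shows "word_perm n (long_word n k l) = standard_involution n k l"
  using assms
proof (induction k)
  case 0
  then show ?case
    by (auto simp: long_word_def fun_eq_iff word_perm_neg_block standard_involution_def)
next
  case (Suc k)
  then show ?case by (simp add: long_word_Suc fun_eq_iff standard_involution_Suc)
qed

text \<open>For a pair of opposite roots \<open>\<plusminus>e\<^sub>a \<plusminus> e\<^sub>b\<close> with \<open>a \<noteq> b\<close> and for a pair \<open>\<plusminus>e\<^sub>a\<close>, exactly two
  pairs \<open>x > y\<close> with \<open>y \<noteq> 0\<close> represent the positive root; so this set has twice as many elements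
  as there are positive roots made negative.\<close>

definition inversions :: "(int \<Rightarrow> int) \<Rightarrow> (int \<times> int) set" where
  "inversions g = {(x, y). y < x \<and> y \<noteq> 0 \<and> g x < g y}"

text \<open>A simple reflection makes only its own simple root negative, and a root is counted by
  two pairs.\<close>

lemma inversions_bc_refl:
  assumes "1 \<le> i" "i \<le> n"
  shows "finite (inversions (bc_refl n i)) \<and> card (inversions (bc_refl n i)) \<le> 2"
proof -
  define s where "s = int n - int i"
  have "\<exists>p q. inversions (bc_refl n i) \<subseteq> {p, q}"
  proof (cases "i = n")
    case True
    then have "inversions (bc_refl n i) \<subseteq> {(1, -1), (0, -1)}"
      by (auto simp: inversions_def bc_refl_last split: if_splits)
    then show ?thesis by blast
  next
    case False
    then have refl: "bc_refl n i x = (if x = s + 1 then s else if x = s then s + 1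
      else if x = - s - 1 then - s else if x = - s then - s - 1 else x)" for x
      using assms by (auto simp: bc_refl_def s_def)
    have "s > 0" using False assms by (simp add: s_def)
    have "(x, y) \<in> {(s + 1, s), (- s, - s - 1)}" if "y < x" "bc_refl n i x < bc_refl n i y" for x y
    proof -
      \<comment> \<open>No integer moves by more than 1, so an inverted pair consists of
        neighbours.\<close>
      have "x - 1 \<le> bc_refl n i x" "bc_refl n i y \<le> y + 1" by (simp_all add: refl)
      then have x: "x = y + 1" using that by linarith
      consider "y = s" | "y = - s - 1" | "y = s - 1" | "y = s + 1" | "y = - s" | "y = - s - 2"
        | "y \<notin> {s, - s - 1, s - 1, s + 1, - s, - s - 2}" by blast
      then show ?thesis
        using that(2) \<open>s > 0\<close> unfolding x by cases (simp_all add: refl split: if_splits)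
    qed
    then have "inversions (bc_refl n i) \<subseteq> {(s + 1, s), (- s, - s - 1)}"
      unfolding inversions_def by blast
    then show ?thesis by blast
  qed
  then obtain p q where pq: "inversions (bc_refl n i) \<subseteq> {p, q}" by blast
  have "card (inversions (bc_refl n i)) \<le> card {p, q}"
    by (rule card_mono) (use pq in auto)
  also have "\<dots> \<le> 2" by (simp add: card_insert_if)
  finally show ?thesis using finite_subset[OF pq] by simp
qed

text \<open>A pair inverted by \<open>g \<circ> t\<close> is inverted by \<open>t\<close>, or its
  image under \<open>t\<close> is inverted by \<open>g\<close>; so each letter adds at most two
  pairs.\<close>

lemma inversions_word_perm:
  assumes "w \<in> lists {1..n}"
  shows "finite (inversions (word_perm n w)) \<and> card (inversions (word_perm n w)) \<le> 2 * length w"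
  using assms
proof (induction w rule: rev_induct)
  case Nil
  have "inversions (id :: int \<Rightarrow> int) = {}" by (auto simp: inversions_def)
  then show ?case by (simp add: id_def)
next
  case (snoc i w)
  let ?t = "bc_refl n i" and ?g = "word_perm n w"
  have i: "1 \<le> i" "i \<le> n" using snoc.prems by auto
  have inj: "?t x = ?t y \<longleftrightarrow> x = y" for x y using bij_bc_refl[OF i(2)] by (simp add: bij_def inj_eq)
  have "?t 0 = 0" by (simp add: bc_refl_def)
  then have zero: "?t y = 0 \<longleftrightarrow> y = 0" for y using inj[of y 0] by simp
  have sub: "inversions (?g \<circ> ?t) \<subseteq> inversions ?t \<union> (\<lambda>(x, y). (?t x, ?t y)) ` inversions ?g"
  proof clarify
    fix x y assume xy: "(x, y) \<in> inversions (?g \<circ> ?t)"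
      and notin: "(x, y) \<notin> (\<lambda>(x, y). (?t x, ?t y)) ` inversions ?g"
    have "(x, y) = (\<lambda>(x, y). (?t x, ?t y)) (?t x, ?t y)"
      using i by (simp add: bc_refl_bc_refl)
    then have "(?t x, ?t y) \<notin> inversions ?g" using notin by blast
    then have "\<not> ?t y < ?t x" using xy zero by (auto simp: inversions_def)
    moreover have "?t x \<noteq> ?t y" using xy inj by (auto simp: inversions_def)
    ultimately show "(x, y) \<in> inversions ?t" using xy by (auto simp: inversions_def)
  qed
  have IH: "finite (inversions ?g)" "card (inversions ?g) \<le> 2 * length w"
    using snoc by auto
  have "card (inversions (?g \<circ> ?t))
      \<le> card (inversions ?t \<union> (\<lambda>(x, y). (?t x, ?t y)) ` inversions ?g)"
    by (rule card_mono[OF _ sub]) (use IH inversions_bc_refl[OF i] in simp)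
  also have "\<dots> \<le> card (inversions ?t) + card ((\<lambda>(x, y). (?t x, ?t y)) ` inversions ?g)"
    by (rule card_Un_le)
  also have "\<dots> \<le> 2 + 2 * length w"
    using inversions_bc_refl[OF i] card_image_le[OF IH(1)] IH(2)
    by (intro add_mono) (auto intro: order_trans)
  finally have "card (inversions (?g \<circ> ?t)) \<le> 2 * length (w @ [i])" by simp
  moreover have "finite (inversions (?g \<circ> ?t))"
    by (rule finite_subset[OF sub]) (use IH inversions_bc_refl[OF i] in simp)
  ultimately show ?case by (simp add: comp_def)
qed

section \<open>Inversion counts of the standard involutions\<close>

lemma card_pairs_of_block:
  "card {(x::int, y). - int l \<le> y \<and> y < x \<and> x \<le> int l \<and> y \<noteq> 0} = 2 * l\<^sup>2"
proof (induction l)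
  case 0
  have eq: "{(x::int, y). - int 0 \<le> y \<and> y < x \<and> x \<le> int 0 \<and> y \<noteq> 0} = {}" by auto
  show ?case unfolding eq by simp
next
  case (Suc l)
  let ?A = "{(x::int, y). - int l \<le> y \<and> y < x \<and> x \<le> int l \<and> y \<noteq> 0}"
  \<comment> \<open>The new pairs have \<open>x = l + 1\<close> or \<open>y = - l - 1\<close>; the
    pair with both goes into \<open>?B\<close> only.\<close>
  let ?B = "{int l + 1} \<times> ({- int l - 1..int l} - {0})"
  let ?C = "{- int l..int l} \<times> {- int l - 1}"
  have eq: "{(x::int, y). - int (Suc l) \<le> y \<and> y < x \<and> x \<le> int (Suc l) \<and> y \<noteq> 0} = ?A \<union> ?B \<union> ?C"
    by auto
  have "?A \<subseteq> {- int l..int l} \<times> {- int l..int l}" by auto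
  then have fin: "finite ?A" by (rule finite_subset) simp
  have "card (?A \<union> ?B \<union> ?C) = card (?A \<union> ?B) + card ?C"
    by (rule card_Un_disjoint) (use fin in auto)
  also have "card (?A \<union> ?B) = card ?A + card ?B"
    by (rule card_Un_disjoint) (use fin in auto)
  also have "card ?B = 2 * l + 1" by (simp add: card_cartesian_product)
  also have "card ?C = 2 * l + 1" by (simp add: card_cartesian_product)
  finally show ?case unfolding eq using Suc.IH by (simp add: power2_eq_square)
qed

text \<open>All pairs inside the block are inverted, two for each of its \<open>l\<^sup>2\<close>
  positive roots; each exchange of neighbouring coordinates adds that pair and its negative. The
  normal forms supply the opposite bound on length.\<close>

lemma inversions_standard_involution:
  assumes "2 * k + l \<le> n" "finite (inversions (standard_involution n k l))"
  shows "2 * (l\<^sup>2 + k) \<le> card (inversions (standard_involution n k l))"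
proof -
  let ?A = "{(x::int, y). - int l \<le> y \<and> y < x \<and> x \<le> int l \<and> y \<noteq> 0}"
  let ?b = "\<lambda>i. (int n - 2 * int i, int n - 2 * int i - 1)"
  let ?c = "\<lambda>i. (1 - (int n - 2 * int i), - (int n - 2 * int i))"
  let ?B = "?b ` {..<k}" and ?C = "?c ` {..<k}"
  have "?A \<subseteq> {- int l..int l} \<times> {- int l..int l}" by auto
  then have fin: "finite ?A" by (rule finite_subset) simp
  have AC: "?A \<inter> ?B = {}" "(?A \<union> ?B) \<inter> ?C = {}" using assms by auto
  have "card (?A \<union> ?B \<union> ?C) = card (?A \<union> ?B) + card ?C"
    by (rule card_Un_disjoint) (use fin AC in auto)
  also have "card (?A \<union> ?B) = card ?A + card ?B"
    by (rule card_Un_disjoint) (use fin AC in auto)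
  also have "card ?A = 2 * l\<^sup>2" by (rule card_pairs_of_block)
  also have "card ?B = k" by (subst card_image) (auto simp: inj_on_def)
  also have "card ?C = k" by (subst card_image) (auto simp: inj_on_def)
  finally have "2 * (l\<^sup>2 + k) = card (?A \<union> ?B \<union> ?C)" by simp
  also have "\<dots> \<le> card (inversions (standard_involution n k l))"
  proof (rule card_mono[OF assms(2)])
    let ?f = "standard_involution n k l"
    have "?f x = - x" if "\<bar>x\<bar> \<le> int l" for x
      using that by (simp add: standard_involution_def)
    then have "?A \<subseteq> inversions ?f"
      by (auto simp: inversions_def)
    moreover have "?f (int n - 2 * int i) = int n - 2 * int i - 1"
      "?f (int n - 2 * int i - 1) = int n - 2 * int i"
      "?f (1 - (int n - 2 * int i)) = - (int n - 2 * int i)"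
      "?f (- (int n - 2 * int i)) = 1 - (int n - 2 * int i)" if "i < k" for i
      using that assms(1) by (simp_all add: standard_involution_def)
    then have "?B \<subseteq> inversions ?f" "?C \<subseteq> inversions ?f"
      using assms(1) by (auto simp: inversions_def)
    ultimately show "?A \<union> ?B \<union> ?C \<subseteq> inversions (standard_involution n k l)" by simp
  qed
  finally show ?thesis .
qed

lemma coxeter_length_long_word:
  assumes "2 * k + l \<le> n"
  shows "l\<^sup>2 + k \<le> coxeter_length (coxeter_class {1..n} (BC_matrix n) (long_word n k l))"
proof (rule coxeter_length_ge)
  show "long_word n k l \<in> lists {1..n}"
    using long_word_in_lists[OF assms] lists_mono[OF I_BC_subset[OF assms]] by blast
  fix v assume v: "bc_eq n (long_word n k l) v"
  have "word_perm n v = standard_involution n k l"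
    using word_perm_cong[OF v] word_perm_long_word[OF assms] by simp
  then have "2 * (l\<^sup>2 + k) \<le> 2 * length v"
    using inversions_word_perm[OF coxeter_eq_lists(2)[OF v]] inversions_standard_involution[OF assms]
    by (metis order_trans)
  then show "l\<^sup>2 + k \<le> length v" by simp
qed

lemma w_BC_I_BC:
  assumes "2 * k + l \<le> n"
  shows "w_BC n (I_BC n k l) = coxeter_class {1..n} (BC_matrix n) (long_word n k l)"
  unfolding w_BC_def longest_element_def
proof (rule the_equality)
  let ?cl = "coxeter_class {1..n} (BC_matrix n)" and ?P = "parabolic {1..n} (BC_matrix n) (I_BC n k l)"
  have P: "?P = ?cl ` lists (I_BC n k l)"
    by (rule BC.parabolic_eq_classes[OF I_BC_subset[OF assms]])
  have mem: "?cl (long_word n k l) \<in> ?P"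
    unfolding P using long_word_in_lists[OF assms] by (rule imageI)
  have normal_form: "\<exists>w'. y = ?cl w' \<and> coxeter_length y \<le> length w' \<and> length w' \<le> l\<^sup>2 + k \<and>
      (length w' = l\<^sup>2 + k \<longrightarrow> w' = long_word n k l)" if y: "y \<in> ?P" for y
  proof -
    obtain w where w: "y = ?cl w" "w \<in> lists (I_BC n k l)"
      using y unfolding P by (rule imageE)
    obtain w' where w': "bc_eq n w w'" "length w' \<le> l\<^sup>2 + k"
      "length w' = l\<^sup>2 + k \<longrightarrow> w' = long_word n k l"
      using long_word_normal_form[OF assms w(2)] by blast
    have "?cl w = ?cl w'"
      by (rule iffD2[OF coxeter_eq_class_iff w'(1)]) (rule coxeter_eq_lists(1)[OF w'(1)])
    then show ?thesis
      using w(1) w'(2,3) coxeter_length_le[OF w'(1)] by (intro exI[of _ w']) simp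
  qed
  show "?cl (long_word n k l) \<in> ?P \<and>
      (\<forall>y\<in>?P. coxeter_length y \<le> coxeter_length (?cl (long_word n k l)))"
    using mem normal_form coxeter_length_long_word[OF assms] by (meson order_trans)
  fix x assume x: "x \<in> ?P \<and> (\<forall>y\<in>?P. coxeter_length y \<le> coxeter_length x)"
  obtain w' where w': "x = ?cl w'" "coxeter_length x \<le> length w'" "length w' \<le> l\<^sup>2 + k"
    "length w' = l\<^sup>2 + k \<longrightarrow> w' = long_word n k l"
    using normal_form x by blast
  \<comment> \<open>A competitor of maximal length is at least as long as the class of
    \<open>long_word\<close>, so its normal form attains the bound.\<close>
  moreover have "l\<^sup>2 + k \<le> coxeter_length x"
    using x mem coxeter_length_long_word[OF assms] by (blast intro: order_trans)
  ultimately show "x = ?cl (long_word n k l)" by simp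
qed

section \<open>Conjugacy of involutions\<close>

lemma signed_perms_minus: "g \<in> signed_perms n \<Longrightarrow> g (- x) = - g x"
  by (simp add: signed_perms_def)

lemma signed_perms_fixes: "g \<in> signed_perms n \<Longrightarrow> int n < \<bar>x\<bar> \<Longrightarrow> g x = x"
  by (simp add: signed_perms_def)

lemma signed_perms_eq_iff: "g \<in> signed_perms n \<Longrightarrow> g x = g y \<longleftrightarrow> x = y"
  by (auto simp: signed_perms_def bij_def inj_eq)

lemma signed_perms_zero: "g \<in> signed_perms n \<Longrightarrow> g 0 = 0"
  using signed_perms_minus[of g n 0] by simp

lemma signed_perms_abs_abs:
  assumes "g \<in> signed_perms n"
  shows "\<bar>g \<bar>x\<bar>\<bar> = \<bar>g x\<bar>"
  using signed_perms_minus[OF assms, of x] by (simp add: abs_if)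

lemma signed_perms_abs_le:
  assumes "g \<in> signed_perms n" "\<bar>x\<bar> \<le> int n"
  shows "\<bar>g x\<bar> \<le> int n"
proof (rule ccontr)
  assume *: "\<not> \<bar>g x\<bar> \<le> int n"
  then have "g (g x) = g x" using signed_perms_fixes[OF assms(1), of "g x"] by simp
  then show False using * assms by (simp add: signed_perms_eq_iff)
qed

text \<open>Generators raise a positive coordinate one place at a time up to \<open>r\<close>; a
  negative one is brought to \<open>- r\<close>, and \<open>neg_word\<close> then changes the
  sign.\<close>

lemma word_perm_transitive:
  assumes "r \<le> n" "y \<noteq> 0" "\<bar>y\<bar> \<le> int r"
  shows "\<exists>u\<in>lists {n - r<..n}. word_perm n u y = int r"
proof -
  have pos: "\<exists>u\<in>lists {n - r<..n}. word_perm n u y = int r" if "r \<le> n" "0 < y" "y \<le> int r" for r y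
    using that
  proof (induction r)
    case (Suc q)
    show ?case
    proof (cases "y = int (Suc q)")
      case True
      then show ?thesis by (intro bexI[of _ "[]"]) auto
    next
      case False
      then obtain u where u: "u \<in> lists {n - q<..n}" "word_perm n u y = int q"
        using Suc by auto
      have "q \<noteq> 0" "n - q \<noteq> n" using False Suc.prems by auto
      then have "bc_refl n (n - q) (int q) = int (Suc q)"
        using Suc.prems by (simp add: bc_refl_def)
      then have "word_perm n ((n - q) # u) y = int (Suc q)" using u by simp
      moreover have "(n - q) # u \<in> lists {n - Suc q<..n}"
        using greaterThanAtMost_lists(1)[OF u(1), of "Suc q"] Suc.prems by auto
      ultimately show ?thesis by blast
    qed
  qed auto
  show ?thesis
  proof (cases "y > 0")
    case True
    then show ?thesis using pos assms by simp
  next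
    case False
    then obtain u where u: "u \<in> lists {n - r<..n}" "word_perm n u (- y) = int r"
      using pos[of r "- y"] assms by auto
    have "word_perm n u \<in> signed_perms n"
      using word_perm_in_signed_perms greaterThanAtMost_lists(2)[OF u(1) order_refl] by blast
    then have "word_perm n u y = - int r" using u(2) signed_perms_minus[of _ n y] by fastforce
    moreover have "1 \<le> r" using assms False by linarith
    ultimately have "word_perm n (neg_word n r @ u) y = int r"
      using word_perm_neg_word[of r n "- int r"] assms(1) by simp
    moreover have "neg_word n r @ u \<in> lists {n - r<..n}"
      using u(1) neg_word_in_lists[OF assms(1)] by simp
    ultimately show ?thesis by blast
  qed
qed

text \<open>Some word \<open>u\<close> brings \<open>g r\<close> back to \<open>r\<close>; composed
  with it, \<open>g\<close> becomes a signed permutation of smaller rank.\<close>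

lemma signed_perm_is_word_perm:
  assumes "g \<in> signed_perms r" "r \<le> n"
  shows "\<exists>w\<in>lists {n - r<..n}. word_perm n w = g"
  using assms
proof (induction r arbitrary: g)
  case 0
  have "g x = x" for x
    using signed_perms_fixes[OF 0(1), of x] signed_perms_zero[OF 0(1)] by (cases "x = 0") auto
  then show ?case by (intro bexI[of _ "[]"]) auto
next
  case (Suc q)
  note g = Suc.prems(1)
  let ?r = "int (Suc q)"
  have "g ?r \<noteq> 0" using signed_perms_eq_iff[OF g, of ?r 0] signed_perms_zero[OF g] by simp
  then obtain u where u: "u \<in> lists {n - Suc q<..n}" "word_perm n u (g ?r) = ?r"
    using word_perm_transitive[OF Suc.prems(2), of "g ?r"] signed_perms_abs_le[OF g, of ?r] by auto
  let ?h = "word_perm n u \<circ> g"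
  note uN = greaterThanAtMost_lists(2,3)[OF u(1) order_refl]
  have SP: "word_perm n u \<in> signed_perms n" by (rule word_perm_in_signed_perms[OF uN(1)])
  have odd: "?h (- x) = - ?h x" for x
    using signed_perms_minus[OF g] signed_perms_minus[OF SP] by simp
  have "?h x = x" if x: "int q < \<bar>x\<bar>" for x
  proof -
    consider "x = ?r" | "x = - ?r" | "?r < \<bar>x\<bar>" using x by linarith
    then show ?thesis
    proof cases
      case 1
      then show ?thesis using u(2) by simp
    next
      case 2
      then show ?thesis using u(2) odd[of ?r] by simp
    next
      case 3
      then show ?thesis
        using signed_perms_fixes[OF g 3] word_perm_fixes[OF u(1) 3 Suc.prems(2)] by simp
    qed
  qed
  moreover have "bij ?h" using g SP by (auto simp: signed_perms_def intro: bij_comp)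
  ultimately have "?h \<in> signed_perms q" using odd by (simp add: signed_perms_def)
  then obtain w where w: "w \<in> lists {n - q<..n}" "word_perm n w = ?h"
    using Suc.IH Suc.prems(2) Suc_leD by blast
  have "word_perm n (rev u @ w) = g"
    using w(2) word_perm_rev(1)[OF uN(2)] by (simp add: fun_eq_iff)
  moreover have "rev u @ w \<in> lists {n - Suc q<..n}"
    using u(1) greaterThanAtMost_lists(1)[OF w(1), of "Suc q"] by (simp add: rev_in_lists)
  ultimately show ?case by blast
qed

lemma signed_perms_eq_word_perms: "signed_perms n = word_perm n ` lists {1..n}"
proof -
  have "{n - n<..n} = {1..n}" by auto
  then show ?thesis
    using signed_perm_is_word_perm[of _ n n] word_perm_in_signed_perms by fastforce
qed

section \<open>Cycle types of signed involutions\<close>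

definition negated_points :: "nat \<Rightarrow> (int \<Rightarrow> int) \<Rightarrow> int set" where
  "negated_points n f = {x \<in> {0<..int n}. f x = - x}"

definition fixed_points :: "nat \<Rightarrow> (int \<Rightarrow> int) \<Rightarrow> int set" where
  "fixed_points n f = {x \<in> {0<..int n}. f x = x}"

text \<open>For an involution these are the larger coordinates of the pairs exchanged up to sign, so
  they count the pairs. The absolute value hides the sign of the exchange on purpose.\<close>

definition lowered_points :: "nat \<Rightarrow> (int \<Rightarrow> int) \<Rightarrow> int set" where
  "lowered_points n f = {x \<in> {0<..int n}. \<bar>f x\<bar> < x}"

lemma finite_points [simp]:
  "finite (negated_points n f)" "finite (fixed_points n f)" "finite (lowered_points n f)"
  by (rule finite_subset[of _ "{0<..int n}"];
      auto simp: negated_points_def fixed_points_def lowered_points_def)+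

text \<open>The map \<open>x -> \<bar>f x\<bar>\<close> matches lowered with raised points, whence
  the factor 2.\<close>

lemma card_points:
  assumes "f \<in> signed_perms n" "\<And>x. f (f x) = x"
  shows "card (negated_points n f) + card (fixed_points n f) + 2 * card (lowered_points n f) = n"
proof -
  let ?N = "negated_points n f" and ?F = "fixed_points n f" and ?A = "lowered_points n f"
  let ?B = "{x \<in> {0<..int n}. x < \<bar>f x\<bar>}"
  have abs: "\<bar>f \<bar>f x\<bar>\<bar> = \<bar>x\<bar>" for x
    using signed_perms_abs_abs[OF assms(1), of "f x"] assms(2) by simp
  have nz: "f x \<noteq> 0" if "x > 0" for x
    using signed_perms_eq_iff[OF assms(1), of x 0] signed_perms_zero[OF assms(1)] that by simp
  have "bij_betw (\<lambda>x. \<bar>f x\<bar>) ?A ?B"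
    by (rule bij_betwI[of _ _ _ "\<lambda>x. \<bar>f x\<bar>"])
      (use abs nz signed_perms_abs_le[OF assms(1)] in \<open>force simp: lowered_points_def\<close>)+
  then have B: "card ?A = card ?B" by (rule bij_betw_same_card)
  have disj: "?N \<inter> ?F = {}" "(?N \<union> ?F) \<inter> ?A = {}" "(?N \<union> ?F \<union> ?A) \<inter> ?B = {}"
    by (auto simp: negated_points_def fixed_points_def lowered_points_def)
  have finB: "finite ?B" by (rule finite_subset[of _ "{0<..int n}"]) auto
  have "{0<..int n} = ?N \<union> ?F \<union> ?A \<union> ?B"
    by (auto simp: negated_points_def fixed_points_def lowered_points_def)
  then have "n = card (?N \<union> ?F \<union> ?A \<union> ?B)"
    by (metis card_greaterThanAtMost_int diff_zero nat_int)
  also have "\<dots> = card ?N + card ?F + card ?A + card ?B"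
    using card_Un_disjoint[OF _ _ disj(1)] card_Un_disjoint[OF _ _ disj(2)]
      card_Un_disjoint[OF _ _ disj(3)] finB by simp
  finally show ?thesis using B by simp
qed

text \<open>A bijection \<open>p\<close> between the points not raised by \<open>f\<close> and those not raised by \<open>g\<close> that respects the three kinds
  of points extends uniquely to a signed permutation conjugating \<open>f\<close> to \<open>g\<close>.\<close>

definition conjugator :: "nat \<Rightarrow> (int \<Rightarrow> int) \<Rightarrow> (int \<Rightarrow> int) \<Rightarrow> (int \<Rightarrow> int) \<Rightarrow> int \<Rightarrow> int" where
  "conjugator n f g p x =
    (if int n < \<bar>x\<bar> then x
     else if \<bar>f x\<bar> \<le> \<bar>x\<bar> then sgn x * p \<bar>x\<bar>
     else g (sgn (f x) * p \<bar>f x\<bar>))"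

text \<open>Only \<open>q\<close> after \<open>p\<close> is assumed to be the identity. A second
  interpretation with \<open>f\<close>, \<open>g\<close> and \<open>p\<close>, \<open>q\<close>
  exchanged gives the other direction, and both together make the conjugator bijective.\<close>

locale signed_involutions =
  fixes n :: nat and f g p q :: "int \<Rightarrow> int"
  assumes f: "f \<in> signed_perms n" "f (f x) = x"
    and g: "g \<in> signed_perms n" "g (g x) = x"
    and p: "\<lbrakk>0 < x; x \<le> int n; \<bar>f x\<bar> \<le> x\<rbrakk> \<Longrightarrow> 0 < p x \<and> p x \<le> int n \<and> q (p x) = x"
    and p_negated: "x \<in> negated_points n f \<Longrightarrow> p x \<in> negated_points n g"
    and p_fixed: "x \<in> fixed_points n f \<Longrightarrow> p x \<in> fixed_points n g"
    and p_lowered: "x \<in> lowered_points n f \<Longrightarrow> p x \<in> lowered_points n g"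
begin

definition P where "P x = sgn x * p \<bar>x\<bar>"

lemma P_minus: "P (- x) = - P x"
  by (simp add: P_def)

lemma abs_P:
  assumes "x \<noteq> 0" "\<bar>x\<bar> \<le> int n" "\<bar>f x\<bar> \<le> \<bar>x\<bar>"
  shows "\<bar>P x\<bar> = p \<bar>x\<bar>" "P x \<noteq> 0" "\<bar>P x\<bar> \<le> int n" "sgn (P x) * q \<bar>P x\<bar> = x"
proof -
  have *: "0 < p \<bar>x\<bar>" "p \<bar>x\<bar> \<le> int n" "q (p \<bar>x\<bar>) = \<bar>x\<bar>"
    using p[of "\<bar>x\<bar>"] assms signed_perms_abs_abs[OF f(1), of x] by auto
  then show a: "\<bar>P x\<bar> = p \<bar>x\<bar>" and "P x \<noteq> 0" and "\<bar>P x\<bar> \<le> int n"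
    using assms(1) by (auto simp: P_def sgn_if split: if_splits)
  show "sgn (P x) * q \<bar>P x\<bar> = x"
    using * assms(1) unfolding a by (simp add: P_def sgn_mult mult_sgn_abs)
qed

lemma negated_pm: "\<bar>x\<bar> \<le> int n \<Longrightarrow> x \<noteq> 0 \<Longrightarrow> h \<in> signed_perms n \<Longrightarrow> h x = - x \<longleftrightarrow> \<bar>x\<bar> \<in> negated_points n h"
  using signed_perms_minus[of h n x] by (auto simp: negated_points_def abs_if)

lemma fixed_pm: "\<bar>x\<bar> \<le> int n \<Longrightarrow> x \<noteq> 0 \<Longrightarrow> h \<in> signed_perms n \<Longrightarrow> h x = x \<longleftrightarrow> \<bar>x\<bar> \<in> fixed_points n h"
  using signed_perms_minus[of h n x] by (auto simp: fixed_points_def abs_if)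

lemma lowered_pm: "\<bar>x\<bar> \<le> int n \<Longrightarrow> x \<noteq> 0 \<Longrightarrow> h \<in> signed_perms n \<Longrightarrow> \<bar>h x\<bar> < \<bar>x\<bar> \<longleftrightarrow> \<bar>x\<bar> \<in> lowered_points n h"
  using signed_perms_abs_abs[of h n x] by (auto simp: lowered_points_def)

lemma P_cases:
  assumes "x \<noteq> 0" "\<bar>x\<bar> \<le> int n" "\<bar>f x\<bar> \<le> \<bar>x\<bar>"
  shows "f x = - x \<and> g (P x) = - P x \<or> f x = x \<and> g (P x) = P x \<or> \<bar>f x\<bar> < \<bar>x\<bar> \<and> \<bar>g (P x)\<bar> < \<bar>P x\<bar>"
proof -
  note P = abs_P[OF assms]
  consider "f x = - x" | "f x = x" | "\<bar>f x\<bar> < \<bar>x\<bar>" using assms(3) by linarith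
  then show ?thesis
  proof cases
    case 1
    then have "g (P x) = - P x"
      using p_negated negated_pm[OF assms(2,1) f(1)] negated_pm[OF P(3,2) g(1)] P(1) by simp
    with 1 show ?thesis by simp
  next
    case 2
    then have "g (P x) = P x"
      using p_fixed fixed_pm[OF assms(2,1) f(1)] fixed_pm[OF P(3,2) g(1)] P(1) by simp
    with 2 show ?thesis by simp
  next
    case 3
    then have "\<bar>g (P x)\<bar> < \<bar>P x\<bar>"
      using p_lowered lowered_pm[OF assms(2,1) f(1)] lowered_pm[OF P(3,2) g(1)] P(1) by simp
    with 3 show ?thesis by simp
  qed
qed

lemma conjugator_eq:
  "conjugator n f g p x = (if int n < \<bar>x\<bar> then x else if \<bar>f x\<bar> \<le> \<bar>x\<bar> then P x else g (P (f x)))"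
  by (simp add: conjugator_def P_def)

lemma raised:
  assumes "\<not> \<bar>f x\<bar> \<le> \<bar>x\<bar>" "\<bar>x\<bar> \<le> int n"
  shows "f x \<noteq> 0" "\<bar>f x\<bar> \<le> int n" "\<bar>f (f x)\<bar> \<le> \<bar>f x\<bar>" "\<bar>g (P (f x))\<bar> < \<bar>P (f x)\<bar>"
proof -
  show *: "f x \<noteq> 0" "\<bar>f x\<bar> \<le> int n" "\<bar>f (f x)\<bar> \<le> \<bar>f x\<bar>"
    using assms signed_perms_abs_le[OF f(1)] f(2) by auto
  show "\<bar>g (P (f x))\<bar> < \<bar>P (f x)\<bar>"
    using P_cases[OF *] assms f(2) by auto
qed

lemma conjugator_minus: "conjugator n f g p (- x) = - conjugator n f g p x"
  by (simp add: conjugator_eq signed_perms_minus[OF f(1)] signed_perms_minus[OF g(1)] P_minus)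

lemma conjugator_inverse: "conjugator n g f q (conjugator n f g p x) = x"
proof -
  consider "int n < \<bar>x\<bar>" | "x = 0" | "x \<noteq> 0" "\<bar>x\<bar> \<le> int n" "\<bar>f x\<bar> \<le> \<bar>x\<bar>"
    | "\<bar>x\<bar> \<le> int n" "\<not> \<bar>f x\<bar> \<le> \<bar>x\<bar>" by linarith
  then show ?thesis
  proof cases
    case 1
    then show ?thesis by (simp add: conjugator_def)
  next
    case 2
    then show ?thesis using signed_perms_zero[OF f(1)] signed_perms_zero[OF g(1)]
      by (simp add: conjugator_def)
  next
    case 3
    then have "\<bar>g (P x)\<bar> \<le> \<bar>P x\<bar>" using P_cases by fastforce
    then show ?thesis using 3 abs_P[OF 3]
      by (subst conjugator_eq) (simp add: conjugator_def)
  next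
    \<comment> \<open>The image \<open>g (P (f x))\<close> is raised by \<open>g\<close>, so the
      reverse conjugator first applies \<open>g\<close> and then returns through
      \<open>P (f x)\<close>.\<close>
    case 4
    note r = raised[OF 4(2,1)]
    note P = abs_P[OF r(1-3)]
    have "\<bar>g (P (f x))\<bar> \<le> int n" using signed_perms_abs_le[OF g(1) P(3)] .
    then show ?thesis using 4 r P f(2) g(2)
      by (subst conjugator_eq) (simp add: conjugator_def)
  qed
qed

lemma conjugator_conjugates: "conjugator n f g p (f x) = g (conjugator n f g p x)"
proof -
  consider "int n < \<bar>x\<bar>" | "x = 0" | "x \<noteq> 0" "\<bar>x\<bar> \<le> int n" "\<bar>f x\<bar> \<le> \<bar>x\<bar>"
    | "\<bar>x\<bar> \<le> int n" "\<not> \<bar>f x\<bar> \<le> \<bar>x\<bar>" by linarith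
  then show ?thesis
  proof cases
    case 1
    then show ?thesis
      using signed_perms_fixes[OF f(1)] signed_perms_fixes[OF g(1)] by (simp add: conjugator_def)
  next
    case 2
    then show ?thesis using signed_perms_zero[OF f(1)] signed_perms_zero[OF g(1)]
      by (simp add: conjugator_def)
  next
    case 3
    have x: "conjugator n f g p x = P x" using 3 by (simp add: conjugator_eq)
    from P_cases[OF 3] consider "f x = - x" "g (P x) = - P x" | "f x = x" "g (P x) = P x"
      | "\<bar>f x\<bar> < \<bar>x\<bar>" by blast
    then show ?thesis
    proof cases
      case 1
      then show ?thesis using x by (simp add: conjugator_minus)
    next
      case 2
      then show ?thesis using x by simp
    next
      case lower: 3
      then have "conjugator n f g p (f x) = g (P (f (f x)))"
        using 3 by (simp add: conjugator_eq f(2))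
      then show ?thesis using x by (simp add: f(2))
    qed
  next
    case 4
    then have "conjugator n f g p (f x) = P (f x)" "conjugator n f g p x = g (P (f x))"
      using raised[OF 4(2,1)] by (simp_all add: conjugator_eq)
    then show ?thesis by (simp add: g(2))
  qed
qed

end

lemma signed_involutions_conjugate:
  assumes f: "f \<in> signed_perms n" "\<And>x. f (f x) = x" and g: "g \<in> signed_perms n" "\<And>x. g (g x) = x"
    and "card (negated_points n f) = card (negated_points n g)"
    and "card (fixed_points n f) = card (fixed_points n g)"
  shows "\<exists>h\<in>signed_perms n. \<forall>x. h (f x) = g (h x)"
proof -
  let ?N = "negated_points n" and ?F = "fixed_points n" and ?A = "lowered_points n"
  let ?D = "\<lambda>f. ?N f \<union> (?F f \<union> ?A f)"
  have "card (?A f) = card (?A g)"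
    using card_points[OF f] card_points[OF g] assms by simp
  with assms obtain p1 p2 p3 where
    "bij_betw p1 (?N f) (?N g)" "bij_betw p2 (?F f) (?F g)" "bij_betw p3 (?A f) (?A g)"
    using finite_same_card_bij finite_points by metis
  moreover define p where "p x = (if x \<in> ?N f then p1 x else if x \<in> ?F f then p2 x else p3 x)" for x
  have disj: "?N f \<inter> (?F f \<union> ?A f) = {}" "?F f \<inter> ?A f = {}" for f
    by (auto simp: negated_points_def fixed_points_def lowered_points_def)
  have "p x = p1 x" if "x \<in> ?N f" for x using that by (simp add: p_def)
  moreover have "p x = p2 x" if "x \<in> ?F f" for x using that disj(1)[of f] by (auto simp: p_def)
  moreover have "p x = p3 x" if "x \<in> ?A f" for x
    using that disj(1)[of f] disj(2)[of f] by (auto simp: p_def)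
  ultimately have p: "bij_betw p (?N f) (?N g)" "bij_betw p (?F f) (?F g)" "bij_betw p (?A f) (?A g)"
    by (simp_all cong: bij_betw_cong)
  then have pD: "bij_betw p (?D f) (?D g)"
    using disj[of g] by (intro bij_betw_combine)
  define q where "q = inv_into (?D f) p"
  have q: "bij_betw q (?N g) (?N f)" "bij_betw q (?F g) (?F f)" "bij_betw q (?A g) (?A f)"
    unfolding q_def by (rule bij_betw_inv_into_subset[OF pD]; use p in \<open>auto simp: bij_betw_def\<close>)+
  have D: "{x. 0 < x \<and> x \<le> int n \<and> \<bar>f x\<bar> \<le> x} = ?D f" for f
    by (auto simp: negated_points_def fixed_points_def lowered_points_def)
  have pos: "0 < x \<and> x \<le> int n" if "x \<in> ?D f" for f x
    using that by (auto simp: negated_points_def fixed_points_def lowered_points_def)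
  have qp: "q (p x) = x" "p x \<in> ?D g" if "x \<in> ?D f" for x
    using that bij_betw_inv_into_left[OF pD] bij_betwE[OF pD] by (simp_all add: q_def)
  have pq: "p (q x) = x" "q x \<in> ?D f" if "x \<in> ?D g" for x
    using that bij_betw_inv_into_right[OF pD] bij_betwE[OF bij_betw_inv_into[OF pD]]
    by (simp_all add: q_def)
  interpret fg: signed_involutions n f g p q
    by unfold_locales
      (use f g pos qp D[of f] bij_betwE[OF p(1)] bij_betwE[OF p(2)] bij_betwE[OF p(3)] in blast)+
  interpret gf: signed_involutions n g f q p
    by unfold_locales
      (use f g pos pq D[of g] bij_betwE[OF q(1)] bij_betwE[OF q(2)] bij_betwE[OF q(3)] in blast)+
  let ?h = "conjugator n f g p"
  have "bij ?h"
    by (rule o_bij[of "conjugator n g f q"])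
      (simp_all add: fun_eq_iff fg.conjugator_inverse gf.conjugator_inverse)
  then have "?h \<in> signed_perms n"
    by (simp add: signed_perms_def fg.conjugator_minus) (simp add: conjugator_def)
  then show ?thesis using fg.conjugator_conjugates by blast
qed

text \<open>\<open>x -> \<bar>h x\<bar>\<close> injects each kind of points of \<open>f\<close> into
  the same kind for \<open>g\<close>. The converse inequality comes from the inverse of
  \<open>h\<close>.\<close>

lemma card_points_le_if_conjugate:
  assumes h: "h \<in> signed_perms n" and f: "f \<in> signed_perms n" and g: "g \<in> signed_perms n"
    and conj: "\<And>x. h (f x) = g (h x)"
  shows "card (negated_points n f) \<le> card (negated_points n g)"
    "card (fixed_points n f) \<le> card (fixed_points n g)"
proof -
  have nz: "h x \<noteq> 0" if "x > 0" for x
    using signed_perms_eq_iff[OF h, of x 0] signed_perms_zero[OF h] that by simp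
  have inj: "inj_on (\<lambda>x. \<bar>h x\<bar>) {0<..int n}"
  proof (rule inj_onI)
    fix x y assume xy: "x \<in> {0<..int n}" "y \<in> {0<..int n}" "\<bar>h x\<bar> = \<bar>h y\<bar>"
    then have "h x = h y \<or> h x = h (- y)" using signed_perms_minus[OF h, of y] by linarith
    then show "x = y" using xy signed_perms_eq_iff[OF h] by auto
  qed
  have g_abs: "g \<bar>y\<bar> = (if y < 0 then - g y else g y)" for y
    using signed_perms_minus[OF g, of y] by (simp add: abs_if)
  show "card (negated_points n f) \<le> card (negated_points n g)"
  proof (rule card_inj_on_le)
    show "inj_on (\<lambda>x. \<bar>h x\<bar>) (negated_points n f)"
      by (rule inj_on_subset[OF inj]) (auto simp: negated_points_def)
    show "(\<lambda>x. \<bar>h x\<bar>) ` negated_points n f \<subseteq> negated_points n g"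
    proof (rule image_subsetI)
      fix x assume x: "x \<in> negated_points n f"
      then have "g (h x) = - h x"
        using conj[of x] signed_perms_minus[OF h] by (simp add: negated_points_def)
      moreover have "\<bar>h x\<bar> \<le> int n" "h x \<noteq> 0"
        using x nz signed_perms_abs_le[OF h, of x] by (auto simp: negated_points_def)
      ultimately show "\<bar>h x\<bar> \<in> negated_points n g" by (auto simp: negated_points_def g_abs)
    qed
  qed simp
  show "card (fixed_points n f) \<le> card (fixed_points n g)"
  proof (rule card_inj_on_le)
    show "inj_on (\<lambda>x. \<bar>h x\<bar>) (fixed_points n f)"
      by (rule inj_on_subset[OF inj]) (auto simp: fixed_points_def)
    show "(\<lambda>x. \<bar>h x\<bar>) ` fixed_points n f \<subseteq> fixed_points n g"
    proof (rule image_subsetI)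
      fix x assume x: "x \<in> fixed_points n f"
      then have "g (h x) = h x"
        using conj[of x] by (simp add: fixed_points_def)
      moreover have "\<bar>h x\<bar> \<le> int n" "h x \<noteq> 0"
        using x nz signed_perms_abs_le[OF h, of x] by (auto simp: fixed_points_def)
      ultimately show "\<bar>h x\<bar> \<in> fixed_points n g" by (auto simp: fixed_points_def g_abs)
    qed
  qed simp
qed

lemma points_standard_involution:
  assumes "2 * k + l \<le> n"
  shows "card (negated_points n (standard_involution n k l)) = l"
    "card (fixed_points n (standard_involution n k l)) = n - 2 * k - l"
proof -
  have N: "standard_involution n k l x = - x \<longleftrightarrow> x \<le> int l"
    and F: "standard_involution n k l x = x \<longleftrightarrow> int l < x \<and> x \<le> int n - 2 * int k"
    if "0 < x" "x \<le> int n" for x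
    using that assms by (simp_all add: standard_involution_def)
  have "negated_points n (standard_involution n k l) = {0<..int l}"
    using assms N by (auto simp: negated_points_def)
  then show "card (negated_points n (standard_involution n k l)) = l" by simp
  have "fixed_points n (standard_involution n k l) = {int l<..int n - 2 * int k}"
    using assms F by (auto simp: fixed_points_def)
  then show "card (fixed_points n (standard_involution n k l)) = n - 2 * k - l"
    using assms by (simp add: nat_diff_distrib)
qed

section \<open>The reflection representation\<close>

declare One_nat_def [simp del]

text \<open>The simple roots are \<open>\<surd>2 \<alpha>\<^sub>i = e\<^sub>i - e\<^bsub>i+1\<^esub>\<close> for \<open>i < n\<close> and \<open>\<alpha>\<^sub>n = e\<^sub>n\<close> in an orthonormal basis;
  \<open>orth_coord n v i\<close> is \<open>\<surd>2\<close> times the coefficient of \<open>e\<^sub>i\<close> in \<open>\<Sum> v\<^sub>i \<alpha>\<^sub>i\<close>, and \<open>signed_coord\<close> extends it to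
  an odd function in the numbering of \<open>bc_refl\<close>.\<close>

definition orth_coord :: "nat \<Rightarrow> (nat \<Rightarrow> real) \<Rightarrow> nat \<Rightarrow> real" where
  "orth_coord n v i = (if i = n then sqrt 2 else 1) * v i - (if 2 \<le> i then v (i - 1) else 0)"

definition signed_coord :: "nat \<Rightarrow> (nat \<Rightarrow> real) \<Rightarrow> int \<Rightarrow> real" where
  "signed_coord n v x =
    (if x = 0 \<or> int n < \<bar>x\<bar> then 0
     else of_int (sgn x) * orth_coord n v (nat (int n + 1 - \<bar>x\<bar>)))"

lemma signed_coord_minus: "signed_coord n v (- x) = - signed_coord n v x"
  by (simp add: signed_coord_def sgn_minus)

lemma simple_reflection_BC:
  assumes "1 \<le> i" "i \<le> n"
  shows "simple_reflection {1..n} (BC_matrix n) i v =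
    v(i := (if 2 \<le> i then (if i = n then sqrt 2 else 1) * v (i - 1) else 0)
         + (if i < n then (if Suc i = n then sqrt 2 else 1) * v (Suc i) else 0) - v i)"
proof -
  \<comment> \<open>The neighbours' terms up to sign: the cosine is 1/2 for label 3 and
    \<open>sqrt 2 / 2\<close> for label 4, decided by the larger end of the edge. For
    \<open>i = 1\<close> the left neighbour 0 lies outside the index set.\<close>
  define l where "l = (if i = n then sqrt 2 / 2 else 1 / 2) * v (i - 1)"
  define r where "r = (if Suc i = n then sqrt 2 / 2 else 1 / 2) * v (Suc i)"
  have "(\<Sum>j\<in>{1..n}. - cos (pi / real (BC_matrix n i j)) * v j) =
      (\<Sum>j\<in>{1..n}. (if j = i then v i else 0) - (if j = i - 1 then l else 0)
        - (if j = Suc i then r else 0))"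
  proof (rule sum.cong[OF HOL.refl])
    fix j assume j: "j \<in> {1..n}"
    consider "j = i" | "Suc j = i" | "j = Suc i" | "Suc i < j \<or> Suc j < i" by linarith
    then show "- cos (pi / real (BC_matrix n i j)) * v j =
      (if j = i then v i else 0) - (if j = i - 1 then l else 0) - (if j = Suc i then r else 0)"
    proof cases
      case 1
      moreover have "i \<noteq> i - 1" using assms by linarith
      ultimately show ?thesis by (simp add: BC_matrix_def)
    next
      case 2
      then show ?thesis using assms j
        by (auto simp: BC_matrix_def l_def cos_45 cos_60)
    next
      case 3
      then show ?thesis using assms j
        by (auto simp: BC_matrix_def r_def cos_45 cos_60)
    next
      case 4
      then show ?thesis using assms j
        by (auto simp: BC_matrix_def)
    qed
  qed
  also have "\<dots> = v i - (if 2 \<le> i then l else 0) - (if i < n then r else 0)"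
    using assms by (auto simp: sum_subtractf)
  finally have sum: "(\<Sum>j\<in>{1..n}. - cos (pi / real (BC_matrix n i j)) * v j) =
      v i - (if 2 \<le> i then l else 0) - (if i < n then r else 0)" .
  show ?thesis
    unfolding simple_reflection_def sum by (auto simp: fun_eq_iff l_def r_def algebra_simps)
qed

text \<open>In orthogonal coordinates the reflections are the usual generators of the
  hyperoctahedral group; at \<open>i = j = n\<close> the scaling \<open>sqrt 2\<close> meets the
  \<open>sqrt 2\<close> of the edge with label 4.\<close>

lemma orth_coord_simple_reflection:
  assumes "1 \<le> i" "i \<le> n" "1 \<le> j" "j \<le> n"
  shows "orth_coord n (simple_reflection {1..n} (BC_matrix n) i v) j =
    (if i = n then (if j = n then - orth_coord n v n else orth_coord n v j)
     else if j = i then orth_coord n v (Suc i) else if j = Suc i then orth_coord n v i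
     else orth_coord n v j)"
proof -
  have sq: "sqrt 2 * (sqrt 2 * x) = 2 * x" for x :: real
    by (simp flip: mult.assoc)
  consider "j = i" "i = n" | "j = i" "i < n" | "j = Suc i" | "j \<noteq> i" "j \<noteq> Suc i"
    using assms by linarith
  then show ?thesis
  proof cases
    case 1
    moreover have "n - 1 \<noteq> n" using assms by linarith
    ultimately show ?thesis using assms
      by (simp add: orth_coord_def simple_reflection_BC algebra_simps sq)
  next
    case 2
    then show ?thesis using assms
      by (auto simp: orth_coord_def simple_reflection_BC algebra_simps)
  next
    case 3
    then show ?thesis using assms
      by (auto simp: orth_coord_def simple_reflection_BC algebra_simps sq)
  next
    case 4
    then show ?thesis using assms
      by (auto simp: orth_coord_def simple_reflection_BC)
  qed
qed

lemma signed_coord_simple_reflection: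
  assumes "1 \<le> i" "i \<le> n"
  shows "signed_coord n (simple_reflection {1..n} (BC_matrix n) i v) x = signed_coord n v (bc_refl n i x)"
proof -
  let ?s = "simple_reflection {1..n} (BC_matrix n) i v"
  have pos: "signed_coord n ?s x = signed_coord n v (bc_refl n i x)" if x: "0 < x" for x
  proof (cases "int n < x")
    case True
    then show ?thesis using assms bc_refl_fixes[of i n x] by (simp add: signed_coord_def)
  next
    case False
    \<comment> \<open>\<open>x\<close> counts coordinates from the end with label 4,
      \<open>orth_coord\<close> from node 1.\<close>
    define j where "j = nat (int n + 1 - x)"
    have j: "1 \<le> j" "j \<le> n" "x = int n + 1 - int j" using False x by (auto simp: j_def)
    have coord: "signed_coord n v x = orth_coord n v (nat (int n + 1 - x))" if "0 < x" "x \<le> int n" for v x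
      using that by (simp add: signed_coord_def)
    have nat_Suc: "nat (1 + int i) = Suc i" by simp
    have lhs: "signed_coord n ?s x = orth_coord n ?s j"
      using x False by (simp add: coord j_def)
    consider "i = n" "j = n" | "i < n" "j = i" | "i < n" "j = Suc i" | "j \<noteq> i" "i < n \<longrightarrow> j \<noteq> Suc i"
      using assms by linarith
    then show ?thesis
    proof cases
      case 1
      then have "x = 1" "bc_refl n i x = - 1" using j by (simp_all add: bc_refl_last)
      then show ?thesis unfolding lhs
        using 1 assms j coord[of 1 v] signed_coord_minus[of n v 1]
        by (simp add: orth_coord_simple_reflection)
    next
      case 2
      then have "bc_refl n i x = int n + 1 - int (Suc i)" using j by (simp add: bc_refl_pos)
      then show ?thesis unfolding lhs
        using 2 assms by (simp add: orth_coord_simple_reflection coord nat_Suc)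
    next
      case 3
      then have "bc_refl n i x = int n + 1 - int i" using j by (simp add: bc_refl_pos)
      then show ?thesis unfolding lhs
        using 3 assms by (simp add: orth_coord_simple_reflection coord)
    next
      case 4
      have "bc_refl n i x = x"
      proof (cases "i = n")
        case True
        then show ?thesis using 4 j x by (simp add: bc_refl_last)
      next
        case False
        then show ?thesis using 4 j x assms by (simp add: bc_refl_pos)
      qed
      then show ?thesis unfolding lhs
        using 4 assms j by (simp add: orth_coord_simple_reflection coord)
    qed
  qed
  consider "0 < x" | "x = 0" | "x < 0" by linarith
  then show ?thesis
  proof cases
    case 2
    then show ?thesis by (simp add: signed_coord_def bc_refl_def)
  next
    case 3
    then show ?thesis using pos[of "- x"] by (simp add: signed_coord_minus bc_refl_minus)
  qed (rule pos)
qed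

abbreviation word_reflection :: "nat \<Rightarrow> nat list \<Rightarrow> (nat \<Rightarrow> real) \<Rightarrow> nat \<Rightarrow> real" where
  "word_reflection n w \<equiv> foldr (simple_reflection {1..n} (BC_matrix n)) w"

text \<open>Acting on vector and coordinate at once avoids the inverse of
  \<open>word_perm n w\<close> that an action on functions would bring in.\<close>

lemma signed_coord_word_reflection:
  assumes "w \<in> lists {1..n}"
  shows "signed_coord n (word_reflection n w v) (word_perm n w x) = signed_coord n v x"
  using assms
  by (induction w rule: list.induct) (simp_all add: signed_coord_simple_reflection bc_refl_bc_refl)

lemma word_reflection_outside:
  assumes "w \<in> lists {1..n}" "j \<notin> {1..n}"
  shows "word_reflection n w v j = v j"
  using assms
proof (induction w rule: list.induct)
  case (Cons i w)
  then have "j \<noteq> i" by auto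
  then show ?case using Cons by (simp add: simple_reflection_def)
qed simp

text \<open>The coordinate change is triangular: coefficient \<open>i\<close> is recovered from
  \<open>orth_coord n v i\<close> and coefficient \<open>i - 1\<close>, starting at
  \<open>v 0\<close>, since 0 is not a node.\<close>

lemma signed_coord_inject:
  assumes "\<And>x. signed_coord n v x = signed_coord n v' x" "\<And>j. j \<notin> {1..n} \<Longrightarrow> v j = v' j"
  shows "v = v'"
proof
  have coord: "orth_coord n v i = orth_coord n v' i" if "1 \<le> i" "i \<le> n" for i
    using assms(1)[of "int n + 1 - int i"] that by (simp add: signed_coord_def)
  have "v i = v' i" if "i \<le> n" for i
    using that
  proof (induction i)
    case 0
    then show ?case using assms(2)[of 0] by simp
  next
    case (Suc i)
    then show ?case using coord[of "Suc i"] by (auto simp: orth_coord_def split: if_splits)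
  qed
  then show "v i = v' i" for i using assms(2)[of i] by (cases "i \<le> n") auto
qed

text \<open>\<open>the_elem\<close> requires all words of a class to act equally. They have the same
  signed permutation, which determines every coordinate; entries outside the nodes are compared too,
  as the equality is one of functions on all vectors.\<close>

lemma reflection_rep_class:
  assumes "w \<in> lists {1..n}"
  shows "reflection_rep {1..n} (BC_matrix n) (coxeter_class {1..n} (BC_matrix n) w) = word_reflection n w"
proof -
  have "word_reflection n w' = word_reflection n w" if eq: "bc_eq n w w'" for w'
  proof
    fix v
    have w': "w' \<in> lists {1..n}" using coxeter_eq_lists(2)[OF eq] .
    have SP: "word_perm n w \<in> signed_perms n" using word_perm_in_signed_perms[OF assms] .
    show "word_reflection n w' v = word_reflection n w v"
    proof (rule signed_coord_inject)
      fix y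
      have "surj (word_perm n w)" using SP by (simp add: signed_perms_def bij_def)
      then obtain x where "y = word_perm n w x" by (rule surjE)
      then show "signed_coord n (word_reflection n w' v) y = signed_coord n (word_reflection n w v) y"
        using signed_coord_word_reflection[OF assms, of v x] signed_coord_word_reflection[OF w', of v x]
          word_perm_cong[OF eq] by simp
    next
      fix j assume "j \<notin> {1..n}"
      then show "word_reflection n w' v j = word_reflection n w v j"
        using word_reflection_outside assms w' by simp
    qed
  qed
  moreover have "bc_eq n w w" using assms by (rule coxeter_eq.refl)
  ultimately have "word_reflection n ` coxeter_class {1..n} (BC_matrix n) w = {word_reflection n w}"
    unfolding coxeter_class_def by blast
  then show ?thesis by (simp add: reflection_rep_def)
qed

section \<open>Involutions of type \<open>BC\<close>\<close>

abbreviation bc_class :: "nat \<Rightarrow> nat list \<Rightarrow> nat list set" where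
  "bc_class n \<equiv> coxeter_class {1..n} (BC_matrix n)"

lemma bc_class_eq_iff:
  assumes "u \<in> lists {1..n}" "v \<in> lists {1..n}"
  shows "bc_class n u = bc_class n v \<longleftrightarrow> word_perm n u = word_perm n v"
  using bc_eq_iff_word_perm[OF assms] coxeter_eq_class_iff[OF assms(1)] by blast

lemma carrier_W_BC: "carrier (W_BC n) = bc_class n ` lists {1..n}"
  by (simp add: W_BC_def carrier_coxeter_group)

lemma mult_W_BC:
  assumes "u \<in> lists {1..n}" "v \<in> lists {1..n}"
  shows "bc_class n u \<otimes>\<^bsub>W_BC n\<^esub> bc_class n v = bc_class n (u @ v)"
  unfolding W_BC_def by (rule mult_coxeter_class[OF assms])

lemma is_involution_bc_class:
  assumes "u \<in> lists {1..n}"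
  shows "is_involution (W_BC n) (bc_class n u) \<longleftrightarrow> (\<forall>x. word_perm n u (word_perm n u x) = x)"
proof -
  have "is_involution (W_BC n) (bc_class n u) \<longleftrightarrow> bc_class n (u @ u) = bc_class n []"
    using assms carrier_W_BC[of n] mult_W_BC[OF assms assms]
    by (auto simp: is_involution_def W_BC_def one_coxeter_group)
  also have "\<dots> \<longleftrightarrow> (\<forall>x. word_perm n u (word_perm n u x) = x)"
    using assms by (subst bc_class_eq_iff) (auto simp: fun_eq_iff)
  finally show ?thesis .
qed

lemma conjugate_in_bc_class:
  assumes u: "u \<in> lists {1..n}" and v: "v \<in> lists {1..n}"
  shows "conjugate_in (W_BC n) (bc_class n u) (bc_class n v) \<longleftrightarrow>
    (\<exists>h\<in>signed_perms n. \<forall>x. h (word_perm n u x) = word_perm n v (h x))"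
proof -
  have conj: "bc_class n v = bc_class n w \<otimes>\<^bsub>W_BC n\<^esub> bc_class n u \<otimes>\<^bsub>W_BC n\<^esub> inv\<^bsub>W_BC n\<^esub> bc_class n w \<longleftrightarrow>
      (\<forall>x. word_perm n w (word_perm n u x) = word_perm n v (word_perm n w x))"
    if w: "w \<in> lists {1..n}" for w
  proof -
    have rw: "rev w \<in> lists {1..n}" using w by (simp add: rev_in_lists)
    have w': "w \<in> lists {..n}" using w lists_mono[of "{1..n}" "{..n}"] by auto
    have inv: "inv\<^bsub>W_BC n\<^esub> bc_class n w = bc_class n (rev w)"
      using BC.inv_coxeter_class[OF w] by (simp add: W_BC_def)
    have "bc_class n w \<otimes>\<^bsub>W_BC n\<^esub> bc_class n u \<otimes>\<^bsub>W_BC n\<^esub> inv\<^bsub>W_BC n\<^esub> bc_class n w =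
        bc_class n (w @ u @ rev w)"
      unfolding inv using u w rw by (simp add: mult_W_BC)
    moreover have "bc_class n v = bc_class n (w @ u @ rev w) \<longleftrightarrow>
        word_perm n v = word_perm n (w @ u @ rev w)"
      using u v w rw by (intro bc_class_eq_iff) simp_all
    moreover have "word_perm n v = word_perm n (w @ u @ rev w) \<longleftrightarrow>
        (\<forall>x. word_perm n w (word_perm n u x) = word_perm n v (word_perm n w x))"
    proof
      assume "word_perm n v = word_perm n (w @ u @ rev w)"
      then show "\<forall>x. word_perm n w (word_perm n u x) = word_perm n v (word_perm n w x)"
        using word_perm_rev(1)[OF w'] by simp
    next
      assume eq: "\<forall>x. word_perm n w (word_perm n u x) = word_perm n v (word_perm n w x)"
      show "word_perm n v = word_perm n (w @ u @ rev w)"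
      proof
        fix x
        show "word_perm n v x = word_perm n (w @ u @ rev w) x"
          using eq[rule_format, of "word_perm n (rev w) x"] word_perm_rev(2)[OF w', of x] by simp
      qed
    qed
    ultimately show ?thesis by simp
  qed
  show ?thesis
    unfolding conjugate_in_def carrier_W_BC signed_perms_eq_word_perms using conj by blast
qed

lemma index_BC_iff: "(k, l) \<in> index_BC n \<longleftrightarrow> 2 * k + l \<le> n"
  by (auto simp: index_BC_def)

lemma standard_involution_in_signed_perms:
  assumes "2 * k + l \<le> n"
  shows "standard_involution n k l \<in> signed_perms n"
    and "long_word n k l \<in> lists {1..n}"
proof -
  show *: "long_word n k l \<in> lists {1..n}"
    using long_word_in_lists[OF assms] lists_mono[OF I_BC_subset[OF assms]] by blast
  show "standard_involution n k l \<in> signed_perms n"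
    using word_perm_in_signed_perms[OF *] word_perm_long_word[OF assms] by simp
qed

lemma standard_involution_involutive:
  assumes kl: "2 * k + l \<le> n"
  shows "standard_involution n k l (standard_involution n k l x) = x"
proof (rule odd_eqI)
  fix x :: int assume x: "x > 0"
  \<comment> \<open>Writing the members of a pair as \<open>n - 2 * t\<close> and
    \<open>n - 2 * t - 1\<close> settles the parity test.\<close>
  consider "x \<le> int l" | "int l < x" "x \<le> int n - 2 * int k \<or> int n < x"
    | t where "int n - 2 * int k < x" "x \<le> int n" "x = int n - 2 * t"
    | t where "int n - 2 * int k < x" "x \<le> int n" "x = int n - 2 * t - 1"
  proof -
    have "\<exists>t. x = int n - 2 * t \<or> x = int n - 2 * t - 1" by presburger
    then obtain t where "x = int n - 2 * t \<or> x = int n - 2 * t - 1" ..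
    then have "x \<le> int l \<or> int l < x \<and> (x \<le> int n - 2 * int k \<or> int n < x) \<or>
        int n - 2 * int k < x \<and> x \<le> int n \<and> (x = int n - 2 * t \<or> x = int n - 2 * t - 1)"
      by linarith
    then show ?thesis using that by blast
  qed
  then show "standard_involution n k l (standard_involution n k l x) = x"
  proof cases
    case 1
    then show ?thesis using x by (simp add: standard_involution_def)
  next
    case 2
    then have "standard_involution n k l x = x"
      using x by (elim disjE) (simp_all add: standard_involution_def)
    then show ?thesis by simp
  next
    case 3
    then have "standard_involution n k l x = int n - 2 * t - 1"
      using x kl by (simp add: standard_involution_def)
    then show ?thesis using 3 x kl by (simp add: standard_involution_def)
  next
    case 4
    then have "standard_involution n k l x = int n - 2 * t"
      using x kl by (simp add: standard_involution_def)
    then show ?thesis using 4 x kl by (simp add: standard_involution_def)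
  qed
qed (simp add: signed_perms_minus[OF standard_involution_in_signed_perms(1)[OF kl]])

lemma c_BC_eq:
  assumes "2 * k + l \<le> n"
  shows "c_BC n k l = bc_class n (long_word n k l)"
  using w_BC_I_BC[OF assms] by (simp add: c_BC_def)

lemma w_BC_UNIV: "w_BC n {1..n} = bc_class n (long_word n 0 n)"
proof -
  have "{n - n<..n} = {1..n}" by auto
  then show ?thesis using w_BC_I_BC[of 0 n n] by (simp add: I_BC_0)
qed

lemma conjugate_c_BC:
  assumes u: "u \<in> lists {1..n}" "\<And>x. word_perm n u (word_perm n u x) = x" and kl: "2 * k + l \<le> n"
  shows "conjugate_in (W_BC n) (bc_class n u) (c_BC n k l) \<longleftrightarrow>
    card (negated_points n (word_perm n u)) = l \<and> card (fixed_points n (word_perm n u)) = n - 2 * k - l"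
    (is "?C \<longleftrightarrow> ?P")
proof -
  let ?f = "word_perm n u" and ?g = "standard_involution n k l"
  note lw = standard_involution_in_signed_perms[OF kl]
  have f: "?f \<in> signed_perms n" by (rule word_perm_in_signed_perms[OF u(1)])
  have C: "?C \<longleftrightarrow> (\<exists>h\<in>signed_perms n. \<forall>x. h (?f x) = ?g (h x))"
    unfolding c_BC_eq[OF kl] conjugate_in_bc_class[OF u(1) lw(2)] word_perm_long_word[OF kl] ..
  show ?thesis
  proof
    assume ?P
    then show ?C unfolding C
      using points_standard_involution[OF kl]
      by (intro signed_involutions_conjugate f u(2) lw(1) standard_involution_involutive[OF kl]) simp_all
  next
    assume ?C
    then obtain h where h: "h \<in> signed_perms n" "\<And>x. h (?f x) = ?g (h x)" using C by blast
    then obtain w where w: "w \<in> lists {1..n}" "h = word_perm n w"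
      using signed_perms_eq_word_perms by blast
    \<comment> \<open>The reversed word yields the inverse of \<open>h\<close>, which turns the
      inequalities between the counts into equalities.\<close>
    define h' where "h' = word_perm n (rev w)"
    have w': "w \<in> lists {..n}" using w(1) lists_mono[of "{1..n}" "{..n}"] by auto
    have h': "h' \<in> signed_perms n"
      unfolding h'_def using w(1) by (intro word_perm_in_signed_perms) (simp add: rev_in_lists)
    have "h' (?g x) = ?f (h' x)" for x
    proof -
      have "?g x = h (?f (h' x))"
        using h(2)[of "h' x"] word_perm_rev(2)[OF w'] by (simp add: w(2) h'_def)
      then show ?thesis using word_perm_rev(1)[OF w'] by (simp add: w(2) h'_def)
    qed
    from card_points_le_if_conjugate[OF h(1) f lw(1) h(2)] card_points_le_if_conjugate[OF h' lw(1) f this]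
    show ?P using points_standard_involution[OF kl] by simp
  qed
qed

theorem mainTheorem3:
  fixes n :: nat
  assumes "n \<ge> 1"
  shows "w_BC n {1..n} \<in> carrier (W_BC n)
    \<and> (\<forall>x\<in>carrier (W_BC n).
          w_BC n {1..n} \<otimes>\<^bsub>W_BC n\<^esub> x = x \<otimes>\<^bsub>W_BC n\<^esub> w_BC n {1..n})
    \<and> (\<forall>v\<in>reflection_space {1..n}.
          reflection_rep {1..n} (BC_matrix n) (w_BC n {1..n}) v = (\<lambda>j. - v j))
    \<and> (\<forall>(k, l)\<in>index_BC n. is_involution (W_BC n) (c_BC n k l))
    \<and> (\<forall>x. is_involution (W_BC n) x \<longrightarrow>
          (\<exists>!p. p \<in> index_BC n \<and> (case p of (k, l) \<Rightarrow> conjugate_in (W_BC n) x (c_BC n k l))))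
    \<and> (\<forall>(k, l)\<in>index_BC n.
          conjugate_in (W_BC n) (w_BC n {1..n} \<otimes>\<^bsub>W_BC n\<^esub> c_BC n k l) (c_BC n k (n - 2 * k - l)))"
proof -
  define w0 where "w0 = long_word n 0 n"
  have w0: "w0 \<in> lists {1..n}" and perm: "word_perm n w0 x = (if \<bar>x\<bar> \<le> int n then - x else x)" for x
    using standard_involution_in_signed_perms(2)[of 0 n n] word_perm_long_word[of 0 n n]
    by (simp_all add: w0_def standard_involution_def)
  have w0_class: "w_BC n {1..n} = bc_class n w0" by (simp add: w_BC_UNIV w0_def)
  have 1: "bc_class n w0 \<in> carrier (W_BC n)" using w0 by (simp add: carrier_W_BC)
  have 2: "bc_class n w0 \<otimes>\<^bsub>W_BC n\<^esub> x = x \<otimes>\<^bsub>W_BC n\<^esub> bc_class n w0" if "x \<in> carrier (W_BC n)" for x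
  proof -
    obtain u where u: "u \<in> lists {1..n}" "x = bc_class n u" using \<open>x \<in> _\<close> carrier_W_BC by blast
    have SP: "word_perm n u \<in> signed_perms n" by (rule word_perm_in_signed_perms[OF u(1)])
    have "word_perm n (w0 @ u) = word_perm n (u @ w0)"
      using signed_perms_abs_le[OF SP] signed_perms_minus[OF SP] signed_perms_fixes[OF SP]
      by (auto simp: fun_eq_iff perm)
    then have "bc_class n (w0 @ u) = bc_class n (u @ w0)"
      using u(1) w0 by (subst bc_class_eq_iff) simp_all
    then show ?thesis using u w0 by (simp add: mult_W_BC)
  qed
  have 3: "reflection_rep {1..n} (BC_matrix n) (bc_class n w0) v = (\<lambda>j. - v j)"
    if v: "v \<in> reflection_space {1..n}" for v
    unfolding reflection_rep_class[OF w0]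
  proof (rule signed_coord_inject)
    fix x
    have "signed_coord n (\<lambda>j. - v j) x = - signed_coord n v x"
      by (simp add: signed_coord_def orth_coord_def algebra_simps)
    moreover have "signed_coord n (word_reflection n w0 v) x = - signed_coord n v x"
    proof (cases "\<bar>x\<bar> \<le> int n")
      case True
      \<comment> \<open>Evaluated at \<open>- x\<close>, which \<open>w0\<close> sends to
        \<open>x\<close>; oddness of \<open>signed_coord\<close> produces the sign.\<close>
      then show ?thesis
        using signed_coord_word_reflection[OF w0, of v "- x"] by (simp add: perm signed_coord_minus)
    next
      case False
      then show ?thesis by (simp add: signed_coord_def)
    qed
    ultimately show "signed_coord n (word_reflection n w0 v) x = signed_coord n (\<lambda>j. - v j) x" by simp
  next
    fix j assume "j \<notin> {1..n}"
    then show "word_reflection n w0 v j = - v j"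
      using word_reflection_outside[OF w0, of j v] v by (simp add: reflection_space_def)
  qed
  have 4: "is_involution (W_BC n) (c_BC n k l)" if kl: "2 * k + l \<le> n" for k l
    unfolding c_BC_eq[OF kl] is_involution_bc_class[OF standard_involution_in_signed_perms(2)[OF kl]]
    using standard_involution_involutive[OF kl] by (simp add: word_perm_long_word[OF kl])
  have 5: "\<exists>!p. p \<in> index_BC n \<and> (case p of (k, l) \<Rightarrow> conjugate_in (W_BC n) x (c_BC n k l))"
    if x: "is_involution (W_BC n) x" for x
  proof -
    obtain u where u: "u \<in> lists {1..n}" "x = bc_class n u"
      using x carrier_W_BC by (auto simp: is_involution_def)
    have inv: "word_perm n u (word_perm n u y) = y" for y
      using x is_involution_bc_class[OF u(1)] u(2) by simp
    let ?f = "word_perm n u"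
    define k where "k = card (lowered_points n ?f)"
    define l where "l = card (negated_points n ?f)"
    have sum: "l + card (fixed_points n ?f) + 2 * k = n"
      using card_points[OF word_perm_in_signed_perms[OF u(1)] inv] by (simp add: k_def l_def)
    \<comment> \<open>Once \<open>l' = l\<close>, equal numbers of fixed points force
      \<open>k' = k\<close>, because \<open>n - 2 * k' - l'\<close> is an exact difference for
      indices in \<open>index_BC n\<close>.\<close>
    have iff: "(k', l') \<in> index_BC n \<and> conjugate_in (W_BC n) x (c_BC n k' l') \<longleftrightarrow> k' = k \<and> l' = l"
      for k' l'
    proof (cases "2 * k' + l' \<le> n")
      case True
      then show ?thesis
        using conjugate_c_BC[OF u(1) inv True] sum by (auto simp: index_BC_iff u(2) l_def)
    next
      case False
      then show ?thesis using sum by (auto simp: index_BC_iff)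
    qed
    show ?thesis
      by (rule ex1I[of _ "(k, l)"]) (use iff in auto)
  qed
  have 6: "conjugate_in (W_BC n) (bc_class n w0 \<otimes>\<^bsub>W_BC n\<^esub> c_BC n k l) (c_BC n k (n - 2 * k - l))"
    if kl: "2 * k + l \<le> n" for k l
  proof -
    let ?g = "standard_involution n k l" and ?u = "w0 @ long_word n k l"
    note g = standard_involution_in_signed_perms[OF kl]
    have u: "?u \<in> lists {1..n}" using w0 g(2) by simp
    have "\<bar>?g x\<bar> \<le> int n \<longleftrightarrow> \<bar>x\<bar> \<le> int n" for x
      using signed_perms_abs_le[OF g(1), of x] signed_perms_fixes[OF g(1), of x] by (cases "\<bar>x\<bar> \<le> int n") auto
    then have f: "word_perm n ?u x = (if \<bar>x\<bar> \<le> int n then - ?g x else ?g x)" for x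
      by (simp add: word_perm_long_word[OF kl] perm)
    have inv: "word_perm n ?u (word_perm n ?u x) = x" for x
      unfolding f
      using signed_perms_abs_le[OF g(1), of x] signed_perms_fixes[OF g(1), of x]
        signed_perms_minus[OF g(1)] standard_involution_involutive[OF kl]
      by simp
    have "negated_points n (word_perm n ?u) = fixed_points n ?g"
      "fixed_points n (word_perm n ?u) = negated_points n ?g"
      unfolding negated_points_def fixed_points_def f by auto
    \<comment> \<open>The target has \<open>n - 2 * k - (n - 2 * k - l) = l\<close> fixed
      points.\<close>
    then have "conjugate_in (W_BC n) (bc_class n ?u) (c_BC n k (n - 2 * k - l))"
      using conjugate_c_BC[OF u inv, of k "n - 2 * k - l"] points_standard_involution[OF kl] kl by simp
    then show ?thesis using w0 g(2) by (simp add: c_BC_eq[OF kl] mult_W_BC)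
  qed
  show ?thesis
    unfolding w0_class using 1 2 3 4 5 6 index_BC_iff by blast
qed

end
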